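(* Let $(M,F:=\sqrt g+\beta)$ be a Randers manifold endowed with the Holmes–Thompson volume form $d\mathfrak m_{HT}$ of $F$. Then, for any $p>1$, $$\frac{1}{\kappa_F^p}\,\lambda_{1,p}(M,g)\leq\lambda_{1,p}(M,F)\leq\kappa_F^p\,\lambda_{1,p}(M,g),$$ where $\lambda_{1,p}(M,g)$ is the first eigenvalue of the $p$-Laplacian on the Riemannian manifold $(M,g)$ and $\kappa_F$ is the reversibility constant of $(M,F)$.
   Context: $M$ is a connected smooth $n$-dimensional manifold without boundary. A Randers metric is a Finsler metric $F(v)=\sqrt{g(v,v)}+\beta(v)$, where $g$ is a Riemannian metric on $M$ and $\beta$ is a $1$-form on $M$ whose norm with respect to $g$ is smaller than one; one writes $\|\beta\|_x$ for the $g$-norm of $\beta$ at $x$ and $\mathbf b=\sup_{x\in M}\|\beta\|_x$. The reversibility constant is $\kappa_F:=\sup_{x\in M}\sup_{v\in T_xM\setminus\{0\}}\frac{F(v)}{F(-v)}$. The dual metric is $F^*(\alpha):=\sup_{v\in T_xM,\,F(v)\le1}\alpha(v)$ for $\alpha\in T_x^*M$. The gradient $\nabla f(x)$ is the Legendre transform of $df(x)$, i.e. the unique maximizer of $v\mapsto df(x)(v)-\frac12F^2(v)$ on $T_xM$; thus $F(\nabla f)=F^*(df)$. The Holmes–Thompson volume form is, in local coordinates, $d\mathfrak m_{HT}=\Big(\frac1{\omega_n}\int_{B_xM}\det g_{ij}(x,v)\,dv^1\cdots dv^n\Big)dx^1\cdots dx^n$, where $g_{ij}(x,v)=\frac12\frac{\partial^2(F^2)}{\partial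 v^i\partial v^j}(x,v)$, $B_xM=\{v\in T_xM:F(x,v)<1\}$ and $\omega_n$ is the volume of the unit ball of Euclidean $\mathbb R^n$. The first eigenvalue of the Finsler $p$-Laplacian with respect to a measure $\mathfrak m$ is $$\lambda_{1,p}(M,F):=\inf_{f\in\mathcal H_0^p}\frac{\int_MF(\nabla f)^p\,d\mathfrak m}{\int_M|f|^p\,d\mathfrak m},\qquad\mathcal H_0^p:=\Big\{f\in W^{1,p}(M)\setminus\{0\}:\int_M|f|^{p-2}f\,d\mathfrak m=0\Big\},$$ where $W^{1,p}(M)$ is the usual Sobolev space, the completion of $C^\infty(M)$; here $\mathfrak m=\mathfrak m_{HT}$. Likewise $\lambda_{1,p}(M,g)$ is the infimum of $\int_M|df|_g^p\,dV_g\big/\int_M|f|^p\,dV_g$ over $f\in W^{1,p}(M)\setminus\{0\}$ with $\int_M|f|^{p-2}f\,dV_g=0$, where $dV_g$ is the Riemannian measure. *)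

theory Defs
  imports "HOL-Analysis.Analysis"
begin

section \<open>Smooth manifolds\<close>

text \<open>The two predicates below are meant for open sets \<open>S\<close> only.\<close>

primrec Ck_on ::
  "nat \<Rightarrow> ('e::euclidean_space \<Rightarrow> 'b::real_normed_vector) \<Rightarrow> 'e set \<Rightarrow> bool" where
  "Ck_on 0 f S \<longleftrightarrow> continuous_on S f"
| "Ck_on (Suc k) f S \<longleftrightarrow>
     (\<forall>x\<in>S. f differentiable (at x)) \<and>
     (\<forall>v. Ck_on k (\<lambda>x. frechet_derivative f (at x) v) S)"

definition smooth_on ::
  "('e::euclidean_space \<Rightarrow> 'b::real_normed_vector) \<Rightarrow> 'e set \<Rightarrow> bool" where
  "smooth_on f S \<longleftrightarrow> (\<forall>k. Ck_on k f S)"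

type_synonym ('a, 'n) chart = "'a set \<times> ('a \<Rightarrow> real ^ 'n)"

definition coord_inv :: "('a, 'n::finite) chart \<Rightarrow> real ^ 'n \<Rightarrow> 'a" where
  "coord_inv c = inv_into (fst c) (snd c)"

definition coord_image :: "('a, 'n::finite) chart \<Rightarrow> (real ^ 'n) set" where
  "coord_image c = snd c ` fst c"

definition is_chart :: "('a::topological_space, 'n::finite) chart \<Rightarrow> bool" where
  "is_chart c \<longleftrightarrow> open (fst c) \<and> open (coord_image c) \<and>
     homeomorphism (fst c) (coord_image c) (snd c) (coord_inv c)"

text \<open>The manifold is the whole type \<open>'a\<close>, of dimension \<open>CARD('n)\<close>; the atlas need not be
  maximal.\<close>

definition smooth_atlas :: "('a::topological_space, 'n::finite) chart set \<Rightarrow> bool" where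
  "smooth_atlas A \<longleftrightarrow> (\<forall>c\<in>A. is_chart c) \<and> (\<Union>c\<in>A. fst c) = UNIV \<and>
     (\<forall>c\<in>A. \<forall>d\<in>A. smooth_on (snd d \<circ> coord_inv c) (snd c ` (fst c \<inter> fst d)))"

definition smooth_fun ::
  "('a, 'n::finite) chart set \<Rightarrow> ('a \<Rightarrow> real) \<Rightarrow> bool" where
  "smooth_fun A f \<longleftrightarrow> (\<forall>c\<in>A. smooth_on (f \<circ> coord_inv c) (coord_image c))"

text \<open>Every tangent space is modelled on \<open>real ^ 'n\<close>: a chart \<open>chart_at A x\<close> around \<open>x\<close> is
  fixed once and for all, and \<open>v :: real ^ 'n\<close> stands for the tangent vector at \<open>x\<close> with
  components \<open>v\<close> in that chart. The choice varies with \<open>x\<close> in no regular way, so smoothness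
  and measurability of tensor fields are always expressed in the charts \<open>c\<close> of the atlas:
  \<open>tangent_of A c x u\<close> is the tangent vector at \<open>x\<close> whose components in the chart \<open>c\<close> are
  \<open>u\<close>. Covectors at \<open>x\<close> are linear maps \<open>real ^ 'n \<Rightarrow> real\<close>.\<close>

definition chart_at :: "('a, 'n::finite) chart set \<Rightarrow> 'a \<Rightarrow> ('a, 'n) chart" where
  "chart_at A x = (SOME c. c \<in> A \<and> x \<in> fst c)"

definition tangent_of ::
  "('a, 'n::finite) chart set \<Rightarrow> ('a, 'n) chart \<Rightarrow> 'a \<Rightarrow> real ^ 'n \<Rightarrow> real ^ 'n" where
  "tangent_of A c x u =
     frechet_derivative (snd (chart_at A x) \<circ> coord_inv c) (at (snd c x)) u"

definition differential ::
  "('a, 'n::finite) chart set \<Rightarrow> ('a \<Rightarrow> real) \<Rightarrow> 'a \<Rightarrow> real ^ 'n \<Rightarrow> real" where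
  "differential A f x v =
     frechet_derivative (f \<circ> coord_inv (chart_at A x)) (at (snd (chart_at A x) x)) v"

definition riemannian_metric ::
  "('a, 'n::finite) chart set \<Rightarrow> ('a \<Rightarrow> real ^ 'n \<Rightarrow> real ^ 'n \<Rightarrow> real) \<Rightarrow> bool" where
  "riemannian_metric A g \<longleftrightarrow>
     (\<forall>x. bilinear (g x) \<and> (\<forall>v w. g x v w = g x w v) \<and> (\<forall>v. v \<noteq> 0 \<longrightarrow> g x v v > 0)) \<and>
     (\<forall>c\<in>A. \<forall>u w. smooth_on
        (\<lambda>y. g (coord_inv c y) (tangent_of A c (coord_inv c y) u)
                               (tangent_of A c (coord_inv c y) w)) (coord_image c))"

definition one_form ::
  "('a, 'n::finite) chart set \<Rightarrow> ('a \<Rightarrow> real ^ 'n \<Rightarrow> real) \<Rightarrow> bool" where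
  "one_form A \<beta> \<longleftrightarrow>
     (\<forall>x. linear (\<beta> x)) \<and>
     (\<forall>c\<in>A. \<forall>u. smooth_on
        (\<lambda>y. \<beta> (coord_inv c y) (tangent_of A c (coord_inv c y) u)) (coord_image c))"


section \<open>Finsler and Randers metrics\<close>

text \<open>\<open>F x v\<close> is the Finsler norm of the tangent vector \<open>v\<close> at \<open>x\<close>.\<close>

type_synonym ('a, 'n) finsler = "'a \<Rightarrow> real ^ 'n \<Rightarrow> real"

definition riemannian_norm ::
  "('a \<Rightarrow> real ^ 'n \<Rightarrow> real ^ 'n \<Rightarrow> real) \<Rightarrow> ('a, 'n::finite) finsler" where
  "riemannian_norm g x v = sqrt (g x v v)"

definition dual ::
  "('a, 'n::finite) finsler \<Rightarrow> 'a \<Rightarrow> (real ^ 'n \<Rightarrow> real) \<Rightarrow> real" where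
  "dual F x \<alpha> = (SUP v \<in> {v. F x v \<le> 1}. \<alpha> v)"

text \<open>\<open>dual (riemannian_norm g) x\<close> is the \<open>g\<close>-norm of covectors at \<open>x\<close>.\<close>

definition randers_data ::
  "('a, 'n::finite) chart set \<Rightarrow> ('a \<Rightarrow> real ^ 'n \<Rightarrow> real ^ 'n \<Rightarrow> real) \<Rightarrow>
   ('a \<Rightarrow> real ^ 'n \<Rightarrow> real) \<Rightarrow> bool" where
  "randers_data A g \<beta> \<longleftrightarrow> riemannian_metric A g \<and> one_form A \<beta> \<and>
     (\<forall>x. dual (riemannian_norm g) x (\<beta> x) < 1)"

definition randers ::
  "('a \<Rightarrow> real ^ 'n \<Rightarrow> real ^ 'n \<Rightarrow> real) \<Rightarrow> ('a \<Rightarrow> real ^ 'n \<Rightarrow> real) \<Rightarrow>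
   ('a, 'n::finite) finsler" where
  "randers g \<beta> x v = sqrt (g x v v) + \<beta> x v"

definition reversibility :: "('a, 'n::finite) finsler \<Rightarrow> ennreal" where
  "reversibility F = (SUP x. SUP v \<in> UNIV - {0}. ennreal (F x v / F x (- v)))"

text \<open>Real powers with \<open>\<infinity> ^ p = \<infinity>\<close> for \<open>p > 0\<close>. As \<open>\<infinity> * 0 = 0\<close> in
  \<open>ennreal\<close>, an upper bound with an infinite factor has to be written out as \<open>\<infinity>\<close>.\<close>

definition epowr :: "ennreal \<Rightarrow> real \<Rightarrow> ennreal" where
  "epowr a p = (if a = \<infinity> then \<infinity> else ennreal (enn2real a powr p))"

definition legendre ::
  "('a, 'n::finite) finsler \<Rightarrow> 'a \<Rightarrow> (real ^ 'n \<Rightarrow> real) \<Rightarrow> real ^ 'n" where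
  "legendre F x \<alpha> = (THE v. is_arg_max (\<lambda>v. \<alpha> v - (F x v)\<^sup>2 / 2) (\<lambda>_. True) v)"


section \<open>Volume measures\<close>

definition density_measure ::
  "('a::topological_space, 'n::finite) chart set \<Rightarrow> (('a, 'n) chart \<Rightarrow> 'a \<Rightarrow> real) \<Rightarrow>
   'a measure" where
  "density_measure A \<sigma> = (THE m. sets m = sets borel \<and>
     (\<forall>c\<in>A. \<forall>B\<in>sets borel. B \<subseteq> fst c \<longrightarrow>
        emeasure m B =
          (\<integral>\<^sup>+ y. ennreal (\<sigma> c (coord_inv c y)) * indicator (snd c ` B) y \<partial>lborel)))"

definition riemannian_density ::
  "('a, 'n::finite) chart set \<Rightarrow> ('a \<Rightarrow> real ^ 'n \<Rightarrow> real ^ 'n \<Rightarrow> real) \<Rightarrow>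
   ('a, 'n) chart \<Rightarrow> 'a \<Rightarrow> real" where
  "riemannian_density A g c x =
     sqrt (det (\<chi> i j. g x (tangent_of A c x (axis i 1)) (tangent_of A c x (axis j 1))))"

definition riemannian_measure ::
  "('a::topological_space, 'n::finite) chart set \<Rightarrow>
   ('a \<Rightarrow> real ^ 'n \<Rightarrow> real ^ 'n \<Rightarrow> real) \<Rightarrow> 'a measure" where
  "riemannian_measure A g = density_measure A (riemannian_density A g)"

text \<open>The matrix \<open>g\<^sub>i\<^sub>j(x, u)\<close>, where \<open>u\<close> are the components of the tangent vector in the
  chart \<open>c\<close>. Its value at \<open>u = 0\<close>, where \<open>F\<^sup>2\<close> need not be twice differentiable, is
  irrelevant below.\<close>

definition fundamental_tensor ::
  "('a, 'n::finite) chart set \<Rightarrow> ('a, 'n) finsler \<Rightarrow> ('a, 'n) chart \<Rightarrow> 'a \<Rightarrow>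
   real ^ 'n \<Rightarrow> real ^ 'n ^ 'n" where
  "fundamental_tensor A F c x u = (\<chi> i j. 1 / 2 *
     frechet_derivative
       (\<lambda>w. frechet_derivative (\<lambda>z. (F x (tangent_of A c x z))\<^sup>2) (at w) (axis j 1))
       (at u) (axis i 1))"

definition holmes_thompson_density ::
  "('a, 'n::finite) chart set \<Rightarrow> ('a, 'n) finsler \<Rightarrow> ('a, 'n) chart \<Rightarrow> 'a \<Rightarrow> real" where
  "holmes_thompson_density A F c x =
     1 / measure lborel (ball (0 :: real ^ 'n) 1) *
     (LINT u : {u. F x (tangent_of A c x u) < 1} | lborel. det (fundamental_tensor A F c x u))"

definition holmes_thompson_measure ::
  "('a::topological_space, 'n::finite) chart set \<Rightarrow> ('a, 'n) finsler \<Rightarrow> 'a measure" where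
  "holmes_thompson_measure A F = density_measure A (holmes_thompson_density A F)"


section \<open>Sobolev spaces and first eigenvalues\<close>

definition measurable_covector_field ::
  "('a::topological_space, 'n::finite) chart set \<Rightarrow> ('a \<Rightarrow> real ^ 'n \<Rightarrow> real) \<Rightarrow> bool" where
  "measurable_covector_field A \<omega> \<longleftrightarrow> (\<forall>x. linear (\<omega> x)) \<and>
     (\<forall>c\<in>A. \<forall>u. (\<lambda>x. \<omega> x (tangent_of A c x u)) \<in> borel_measurable (restrict_space borel (fst c)))"

text \<open>The \<open>p\<close>-th power of the Sobolev norm of the pair \<open>(f, \<omega>)\<close>. The dual metric is
  symmetrised, so that this is the power of a norm also for non-reversible \<open>F\<close>; for
  \<open>F = riemannian_norm g\<close> the second integrand is the \<open>p\<close>-th power of the \<open>g\<close>-norm.\<close>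

definition sobolev_energy ::
  "('a, 'n::finite) finsler \<Rightarrow> 'a measure \<Rightarrow> real \<Rightarrow> ('a \<Rightarrow> real) \<Rightarrow>
   ('a \<Rightarrow> real ^ 'n \<Rightarrow> real) \<Rightarrow> ennreal" where
  "sobolev_energy F m p f \<omega> =
     (\<integral>\<^sup>+ x. ennreal (\<bar>f x\<bar> powr p) \<partial>m) +
     (\<integral>\<^sup>+ x. ennreal (max (dual F x (\<omega> x)) (dual F x (\<lambda>v. - \<omega> x v)) powr p) \<partial>m)"

text \<open>The completion of the smooth functions of finite norm, realised as the closure of the
  pairs \<open>(u, du)\<close> among the \<open>p\<close>-integrable pairs \<open>(f, \<omega>)\<close>; \<open>\<omega>\<close> is the weak differential
  of \<open>f\<close>, determined almost everywhere by \<open>f\<close>.\<close>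

definition sobolev ::
  "('a::topological_space, 'n::finite) chart set \<Rightarrow> ('a, 'n) finsler \<Rightarrow> 'a measure \<Rightarrow> real \<Rightarrow>
   (('a \<Rightarrow> real) \<times> ('a \<Rightarrow> real ^ 'n \<Rightarrow> real)) set" where
  "sobolev A F m p = {(f, \<omega>). f \<in> borel_measurable m \<and> measurable_covector_field A \<omega> \<and>
     (\<exists>u. (\<forall>k::nat. smooth_fun A (u k) \<and>
                    sobolev_energy F m p (u k) (differential A (u k)) < \<infinity>) \<and>
          (\<lambda>k. sobolev_energy F m p (\<lambda>x. u k x - f x)
                 (\<lambda>x v. differential A (u k) x v - \<omega> x v)) \<longlonglongrightarrow> 0)}"

text \<open>\<open>has_bochner_integral\<close> rather than an equation between integrals, because the
  integral of a non-integrable function is \<open>0\<close> by convention, and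
  \<open>\<bar>f\<bar> powr (p - 2) * f\<close> need not be integrable when \<open>m\<close> is infinite.\<close>

definition admissible ::
  "('a::topological_space, 'n::finite) chart set \<Rightarrow> ('a, 'n) finsler \<Rightarrow> 'a measure \<Rightarrow> real \<Rightarrow>
   (('a \<Rightarrow> real) \<times> ('a \<Rightarrow> real ^ 'n \<Rightarrow> real)) set" where
  "admissible A F m p = {(f, \<omega>) \<in> sobolev A F m p. \<not> (AE x in m. f x = 0) \<and>
     has_bochner_integral m (\<lambda>x. \<bar>f x\<bar> powr (p - 2) * f x) 0}"

definition eigenvalue_finsler ::
  "('a::topological_space, 'n::finite) chart set \<Rightarrow> ('a, 'n) finsler \<Rightarrow> 'a measure \<Rightarrow> real \<Rightarrow>
   ennreal" where
  "eigenvalue_finsler A F m p = (INF (f, \<omega>) \<in> admissible A F m p.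
     (\<integral>\<^sup>+ x. ennreal (F x (legendre F x (\<omega> x)) powr p) \<partial>m) /
     (\<integral>\<^sup>+ x. ennreal (\<bar>f x\<bar> powr p) \<partial>m))"

definition eigenvalue_riemannian ::
  "('a::topological_space, 'n::finite) chart set \<Rightarrow>
   ('a \<Rightarrow> real ^ 'n \<Rightarrow> real ^ 'n \<Rightarrow> real) \<Rightarrow> real \<Rightarrow> ennreal" where
  "eigenvalue_riemannian A g p =
     (INF (f, \<omega>) \<in> admissible A (riemannian_norm g) (riemannian_measure A g) p.
       (\<integral>\<^sup>+ x. ennreal (dual (riemannian_norm g) x (\<omega> x) powr p) \<partial>riemannian_measure A g) /
       (\<integral>\<^sup>+ x. ennreal (\<bar>f x\<bar> powr p) \<partial>riemannian_measure A g))"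

end

theory Submission
  imports Defs
begin

text \<open>The two eigenvalues are infima of Rayleigh quotients that differ in the measure, in the
integrand of the numerator and in the Sobolev space. The measures turn out to be equal, and the
other two differ by factors controlled by the reversibility constant \<open>\<kappa>\<close>.

Measures. The matrix \<open>g\<^sub>i\<^sub>j(x, v)\<close> is the derivative of the Legendre map \<open>v \<mapsto> d(F\<^sup>2 / 2)\<close>, which maps
the unit ball of \<open>F\<close> bijectively onto the dual unit ball. Hence the Holmes--Thompson density is the
volume of the dual unit ball up to the constant \<open>\<omega>\<^sub>n\<close>. In a \<open>g\<close>-orthonormal frame \<open>F y = \<bar>y\<bar> + a \<bullet> y\<close>
with \<open>\<bar>a\<bar> < 1\<close>, and this is the support function of the unit ball around \<open>a\<close>; so the dual unit ball
is a translate of the one of \<open>g\<close> and has the same volume (\<open>legendre_map_image\<close>,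
\<open>integral_det_legendre\<close>, \<open>holmes_thompson_measure_randers\<close>).

Integrands. The same description of the dual ball gives an explicit maximizer of
\<open>\<alpha> v - (F v)\<^sup>2 / 2\<close>, its uniqueness, and \<open>F (\<nabla>f) = F\<^sup>* (df)\<close> (\<open>randers_maximizer\<close>,
\<open>legendre_dual_randers\<close>). Adding \<open>F v + F (- v) = 2 * \<bar>v\<bar>\<close> to \<open>F v \<le> \<kappa> * F (- v)\<close> shows that
\<open>\<bar>v\<bar> / \<kappa> \<le> F v \<le> \<kappa> * \<bar>v\<bar>\<close> for finite \<open>\<kappa>\<close>, and the same bounds follow for the dual norms
(\<open>randers_comparable\<close>, \<open>dual_comparable_randers\<close>).

Sobolev spaces. Comparable dual norms give comparable Sobolev norms, hence equal spaces
(\<open>sobolev_subset\<close>). So for finite \<open>\<kappa>\<close> the quotients are compared term by term, over one set of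
admissible functions. For infinite \<open>\<kappa>\<close> the bounds are \<open>0\<close> and \<open>\<infinity>\<close>.\<close>

section \<open>Change of variables over an arbitrary finite index type\<close>

text \<open>The change-of-variables formula is applied on \<open>real ^ 'm\<close> with a well-ordered index type \<open>'m\<close>, as
\<open>has_measure_differentiable_image\<close> states it. This copy of \<open>'n\<close>, made of the numbers below its
cardinality, carries such an order, and the lemmas after it move the formula back to \<open>'n\<close> along an arbitrary bijection.\<close>

typedef ('n::finite) index = "{..<CARD('n)}"
  by (rule exI[of _ 0]) simp

instantiation index :: (finite) wellorder
begin
definition less_eq_index :: "'a index \<Rightarrow> 'a index \<Rightarrow> bool" where
  "less_eq_index i j \<longleftrightarrow> Rep_index i \<le> Rep_index j"
definition less_index :: "'a index \<Rightarrow> 'a index \<Rightarrow> bool" where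
  "less_index i j \<longleftrightarrow> Rep_index i < Rep_index j"
instance
proof
  fix P :: "'a index \<Rightarrow> bool" and i :: "'a index"
  assume step: "\<And>i. (\<And>j. j < i \<Longrightarrow> P j) \<Longrightarrow> P i"
  show "P i"
    by (induction "Rep_index i" arbitrary: i rule: less_induct) (metis step less_index_def)
qed (auto simp: less_eq_index_def less_index_def Rep_index_inject)
end

lemma range_Rep_index: "range (Rep_index :: 'n::finite index \<Rightarrow> nat) = {..<CARD('n)}"
  using type_definition.Rep_range[OF type_definition_index] .

instance index :: (finite) finite
proof
  have "finite (range (Rep_index :: 'a index \<Rightarrow> nat))"
    by (simp add: range_Rep_index)
  then show "finite (UNIV :: 'a index set)"
    by (rule finite_imageD) (simp add: inj_on_def Rep_index_inject)
qed

lemma ex_index_bij: "\<exists>h :: 'n::finite index \<Rightarrow> 'n. bij h"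
proof -
  have "card (UNIV :: 'n index set) = card (range (Rep_index :: 'n index \<Rightarrow> nat))"
    by (simp add: card_image inj_on_def Rep_index_inject)
  then have "CARD('n index) = CARD('n)"
    by (simp add: range_Rep_index)
  then show ?thesis
    by (metis finite_class.finite_UNIV finite_same_card_bij)
qed

text \<open>Conjugation by the bijection \<open>h\<close> matches the permutations in the two Leibniz formulas and
preserves their signs.\<close>

lemma det_reindex:
  fixes A :: "real ^ 'n ^ 'n" and h :: "'m::finite \<Rightarrow> 'n::finite"
  assumes h: "bij h"
  shows "det (\<chi> i j. A $ h i $ h j) = det A"
proof -
  let ?P = "\<lambda>q. map_permutation UNIV h q"
  have range_h: "range h = UNIV" and inj_h: "inj h"
    using h by (auto simp: bij_def)
  have P: "?P q = h \<circ> q \<circ> inv h" for q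
    by (auto simp: map_permutation_def range_h restrict_id_def fun_eq_iff)
  have bij: "bij_betw ?P {q. q permutes UNIV} {q. q permutes UNIV}"
  proof (rule bij_betw_byWitness[where f' = "\<lambda>q. inv h \<circ> q \<circ> h"])
    show "\<forall>q\<in>{q. q permutes UNIV}. inv h \<circ> ?P q \<circ> h = q"
      unfolding P by (auto simp: fun_eq_iff inj_h)
    show "\<forall>q\<in>{q. q permutes UNIV}. ?P (inv h \<circ> q \<circ> h) = q"
      unfolding P by (auto simp: fun_eq_iff surj_f_inv_f[OF range_h])
    show "?P ` {q. q permutes UNIV} \<subseteq> {q. q permutes UNIV}"
      using map_permutation_permutes[of h UNIV UNIV] h by auto
    show "(\<lambda>q. inv h \<circ> q \<circ> h) ` {q. q permutes UNIV} \<subseteq> {q. q permutes UNIV}"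
      using h by (auto intro!: bij_imp_permutes bij_comp bij_imp_bij_inv permutes_bij)
  qed
  have "det A = (\<Sum>q\<in>{q. q permutes UNIV}. of_int (sign (?P q)) * (\<Prod>k\<in>UNIV. A $ k $ ?P q k))"
    unfolding det_def by (rule sum.reindex_bij_betw[OF bij, symmetric])
  also have "\<dots> = (\<Sum>q\<in>{q. q permutes UNIV}. of_int (sign q) * (\<Prod>i\<in>UNIV. A $ h i $ h (q i)))"
  proof (rule sum.cong[OF refl])
    fix q :: "'m \<Rightarrow> 'm" assume q: "q \<in> {q. q permutes UNIV}"
    have "(\<Prod>k\<in>UNIV. A $ k $ ?P q k) = (\<Prod>i\<in>UNIV. A $ h i $ ?P q (h i))"
      by (rule prod.reindex_bij_betw[OF h, symmetric])
    also have "\<dots> = (\<Prod>i\<in>UNIV. A $ h i $ h (q i))"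
      by (simp add: P inj_h)
    finally show "of_int (sign (?P q)) * (\<Prod>k\<in>UNIV. A $ k $ ?P q k) =
        (of_int (sign q) * (\<Prod>i\<in>UNIV. A $ h i $ h (q i)) :: real)"
      using q sign_map_permutation[of h UNIV q] inj_h by simp
  qed
  also have "\<dots> = det (\<chi> i j. A $ h i $ h j)"
    by (simp add: det_def)
  finally show ?thesis ..
qed

lemma distr_lborel_reindex:
  fixes h :: "'m::finite \<Rightarrow> 'n::finite"
  assumes h: "bij h"
  shows "distr lborel borel (\<lambda>x :: real ^ 'n. \<chi> i. x $ h i) = lborel"
proof -
  define R where "R = (\<lambda>x :: real ^ 'n. \<chi> i. x $ h i)"
  have R[measurable]: "R \<in> borel_measurable borel"
    unfolding R_def by (intro borel_measurable_continuous_onI continuous_intros)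
  have "lborel = distr lborel borel R"
  proof (rule lborel_eqI)
    fix l u :: "real ^ 'm"
    assume lu: "\<And>b. b \<in> Basis \<Longrightarrow> l \<bullet> b \<le> u \<bullet> b"
    have le: "l $ i \<le> u $ i" for i
      using lu[of "axis i 1"] by (simp add: inner_axis)
    define E where "E = (\<lambda>x :: real ^ 'm. (\<chi> k. x $ inv h k) :: real ^ 'n)"
    have hinv: "h (inv h k) = k" "inv h (h i) = i" for k i
      using h by (auto simp: bij_def surj_f_inv_f)
    have "R -` box l u = box (E l) (E u)"
      by (auto simp: mem_box_cart R_def E_def) (metis hinv)+
    then have "emeasure (distr lborel borel R) (box l u) = emeasure lborel (box (E l) (E u))"
      by (simp add: emeasure_distr)
    also have "\<dots> = (\<Prod>b\<in>Basis. (E u - E l) \<bullet> b)"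
      by (intro emeasure_lborel_box) (auto simp: Basis_vec_def inner_axis E_def le)
    also have "(\<Prod>b\<in>Basis. (E u - E l) \<bullet> b) = (\<Prod>k\<in>UNIV. (E u - E l) $ k)"
      by (simp add: Basis_vec_def cart_eq_inner_axis UNION_singleton_eq_range prod.reindex inj_on_def axis_eq_axis)
    also have "\<dots> = (\<Prod>i\<in>UNIV. (u - l) $ i)"
      unfolding prod.reindex_bij_betw[OF h, symmetric] by (simp add: E_def hinv)
    also have "\<dots> = (\<Prod>b\<in>Basis. (u - l) \<bullet> b)"
      by (simp add: Basis_vec_def cart_eq_inner_axis UNION_singleton_eq_range prod.reindex inj_on_def axis_eq_axis)
    finally show "emeasure (distr lborel borel R) (box l u) = (\<Prod>b\<in>Basis. (u - l) \<bullet> b)" .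
  qed simp
  then show ?thesis
    by (simp add: R_def)
qed

text \<open>The change-of-variables formula for an arbitrary finite index type, in the Borel form used below:
the volume of an injective image is the integral of the Jacobian. Transported to the well-ordered
index type by the coordinate permutations \<open>R\<close> and \<open>E\<close>, which preserve both the Lebesgue measure
and the determinants.\<close>

lemma set_integral_abs_jacobian:
  fixes f :: "real ^ 'n::finite \<Rightarrow> real ^ 'n"
  assumes S: "S \<in> sets borel"
    and der: "\<And>x. x \<in> S \<Longrightarrow> (f has_derivative f' x) (at x)"
    and inj: "inj_on f S"
    and meas: "(\<lambda>x. indicator S x * \<bar>det (matrix (f' x))\<bar>) \<in> borel_measurable borel"
    and image: "f ` S \<in> sets borel" "emeasure lborel (f ` S) < \<infinity>"
  shows "(LINT x : S | lborel. \<bar>det (matrix (f' x))\<bar>) = measure lborel (f ` S)"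
proof -
  obtain h :: "'n index \<Rightarrow> 'n" where h: "bij h"
    using ex_index_bij by blast
  have hinv[simp]: "h (inv h k) = k" "inv h (h i) = i" for k i
    using h by (auto simp: bij_def surj_f_inv_f)
  define R where "R = (\<lambda>x :: real ^ 'n. (\<chi> i. x $ h i) :: real ^ 'n index)"
  define E where "E = (\<lambda>x :: real ^ 'n index. (\<chi> k. x $ inv h k) :: real ^ 'n)"
  have RE[simp]: "R (E y) = y" "E (R x) = x" for x y
    by (auto simp: R_def E_def vec_eq_iff)
  have lin: "bounded_linear R" "bounded_linear E"
    unfolding R_def E_def by (auto intro!: linear_conv_bounded_linear[THEN iffD1] linearI simp: vec_eq_iff)
  have [measurable]: "R \<in> borel_measurable borel" "E \<in> borel_measurable borel"
    using lin by (auto intro!: borel_measurable_continuous_onI linear_continuous_on)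
  have image_R: "R ` T = E -` T" for T
    by (auto simp: image_iff) (metis RE)+
  have distr: "distr lborel borel R = lborel" "distr lborel borel E = lborel"
    unfolding R_def E_def using distr_lborel_reindex h bij_imp_bij_inv[OF h] by blast+
  define f1 where "f1 = R \<circ> f \<circ> E"
  define f1' where "f1' = (\<lambda>y. R \<circ> f' (E y) \<circ> E)"
  have RS: "R ` T \<in> sets borel" if "T \<in> sets borel" for T
    unfolding image_R using measurable_sets_borel[of E borel T] that by simp
  have f1_image: "f1 ` R ` S = R ` f ` S"
    by (auto simp: f1_def image_image)
  have det_eq: "det (matrix (f1' y)) = det (matrix (f' (E y)))" for y
  proof -
    have "E (axis j 1) = axis (h j) 1" for j
      by (auto simp: E_def axis_def vec_eq_iff)
    then have "matrix (f1' y) = (\<chi> i j. matrix (f' (E y)) $ h i $ h j)"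
      by (simp add: matrix_def f1'_def R_def)
    then show ?thesis
      by (simp add: det_reindex[OF h])
  qed
  have emeasure_R: "emeasure lborel (R ` T) = emeasure lborel T" if T: "T \<in> sets borel" for T
  proof -
    have "emeasure lborel T = emeasure (distr lborel borel E) T"
      by (simp add: distr)
    also have "\<dots> = emeasure lborel (E -` T)"
      using T by (subst emeasure_distr) auto
    finally show ?thesis
      by (simp add: image_R)
  qed
  have "f1 ` R ` S \<in> lmeasurable \<and> measure lebesgue (f1 ` R ` S) = measure lborel (f ` S)"
    using RS[OF image(1)] image(2) emeasure_R[OF image(1)]
    by (auto simp: f1_image fmeasurable_def measure_def measure_completion)
  moreover have "R ` S \<in> sets lebesgue"
    using RS[OF S] by simp
  moreover have "(f1 has_derivative f1' y) (at y within R ` S)" if "y \<in> R ` S" for y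
  proof -
    have "E y \<in> S"
      using that by auto
    then have "(f has_derivative f' (E y)) (at (E y))"
      by (rule der)
    then have "(f1 has_derivative f1' y) (at y)"
      unfolding f1_def f1'_def
      using lin by (intro diff_chain_at bounded_linear_imp_has_derivative) auto
    then show ?thesis
      by (rule has_derivative_at_withinI)
  qed
  moreover have "inj_on f1 (R ` S)"
    using inj by (auto simp: inj_on_def f1_def) (metis RE(2))
  ultimately have int: "((\<lambda>y. \<bar>det (matrix (f1' y))\<bar>) has_integral measure lborel (f ` S)) (R ` S)"
    using has_measure_differentiable_image[of "R ` S" f1 f1'] by blast
  let ?J = "\<lambda>x. indicator S x * \<bar>det (matrix (f' x))\<bar>"
  have "((\<lambda>y. ?J (E y)) has_integral measure lborel (f ` S)) UNIV"
    using int unfolding has_integral_restrict_UNIV[symmetric, of _ _ "R ` S"]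
    by (rule has_integral_eq[rotated]) (auto simp: det_eq image_R indicator_def)
  then have "has_bochner_integral lborel (\<lambda>y. ?J (E y)) (measure lborel (f ` S))"
    using meas by (intro has_bochner_integral_nn_integral)
      (auto simp: nn_integral_has_integral_lborel)
  then have "has_bochner_integral (distr lborel borel E) ?J (measure lborel (f ` S))"
    using meas by (subst has_bochner_integral_distr) auto
  then show ?thesis
    by (simp add: distr has_bochner_integral_integral_eq set_lebesgue_integral_def)
qed

section \<open>Orthonormal frames\<close>

text \<open>Gram--Schmidt: a \<open>B\<close>-orthonormal family that does not span is extended by the normalised
\<open>B\<close>-orthogonal part of a vector outside its span. Independence is carried along in the induction
so that the cardinality bounds the dimension of the span.\<close>

lemma orthonormal_independent_exists:
  fixes B :: "'e::euclidean_space \<Rightarrow> 'e \<Rightarrow> real"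
  assumes B: "bilinear B" and sym: "\<And>v w. B v w = B w v" and pos: "\<And>v. v \<noteq> 0 \<Longrightarrow> B v v > 0"
    and k: "k \<le> DIM('e)"
  shows "\<exists>S. finite S \<and> card S = k \<and> independent S \<and>
    (\<forall>s\<in>S. \<forall>t\<in>S. B s t = (if s = t then 1 else 0))"
  using k
proof (induction k)
  case 0
  show ?case
    by (rule exI[of _ "{}"]) (simp add: independent_empty)
next
  case (Suc k)
  then obtain S where S: "finite S" "card S = k" "independent S"
    and orth: "\<And>s t. s \<in> S \<Longrightarrow> t \<in> S \<Longrightarrow> B s t = (if s = t then 1 else 0)"
    by force
  have "span S \<noteq> UNIV"
  proof
    assume "span S = UNIV"
    then have "DIM('e) = dim S"
      by (metis dim_UNIV dim_span)
    then show False
      using S Suc.prems by (simp add: dim_eq_card_independent)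
  qed
  then obtain v where v: "v \<notin> span S"
    by blast
  define w where "w = v - (\<Sum>s\<in>S. B v s *\<^sub>R s)"
  have "w \<notin> span S"
  proof
    assume "w \<in> span S"
    moreover have "(\<Sum>s\<in>S. B v s *\<^sub>R s) \<in> span S"
      by (intro span_sum span_scale span_base)
    ultimately have "w + (\<Sum>s\<in>S. B v s *\<^sub>R s) \<in> span S"
      by (rule span_add)
    then show False
      using v by (simp add: w_def)
  qed
  have Bw: "B w t = 0" if "t \<in> S" for t
  proof -
    have lin: "linear (\<lambda>x. B x t)"
      using B by (simp add: bilinear_def)
    have "B (\<Sum>s\<in>S. B v s *\<^sub>R s) t = (\<Sum>s\<in>S. B v s * B s t)"
      by (simp add: linear_sum[OF lin] linear_scale[OF lin])
    also have "\<dots> = (\<Sum>s\<in>S. if s = t then B v s else 0)"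
      by (rule sum.cong) (auto simp: orth that)
    also have "\<dots> = B v t"
      using that S by simp
    finally show ?thesis
      using B by (simp add: w_def bilinear_lsub)
  qed
  have "w \<noteq> 0"
    using \<open>w \<notin> span S\<close> span_zero by blast
  then have Bww: "B w w > 0"
    by (rule pos)
  define e where "e = w /\<^sub>R sqrt (B w w)"
  have "e \<notin> span S"
  proof
    assume "e \<in> span S"
    then have "sqrt (B w w) *\<^sub>R e \<in> span S"
      by (rule span_scale)
    then show False
      using Bww \<open>w \<notin> span S\<close> by (simp add: e_def)
  qed
  then have "e \<notin> S"
    using span_base by blast
  have Be: "B e t = 0" "B t e = 0" if "t \<in> S" for t
    using B Bw[OF that] sym[of t e] by (simp_all add: e_def bilinear_lmul)
  moreover have "B e e = 1"
    using B Bww by (simp add: e_def bilinear_lmul bilinear_rmul field_simps)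
  ultimately have "\<forall>s\<in>insert e S. \<forall>t\<in>insert e S. B s t = (if s = t then 1 else 0)"
    using orth \<open>e \<notin> S\<close> by auto
  moreover have "independent (insert e S)"
    using S \<open>e \<notin> span S\<close> by (simp add: independent_insert \<open>e \<notin> S\<close>)
  ultimately show ?case
    using S \<open>e \<notin> S\<close> by (intro exI[of _ "insert e S"]) simp
qed

text \<open>Sending the standard basis to a \<open>B\<close>-orthonormal one is an isometry; \<open>M\<close> is its inverse.\<close>

lemma positive_definite_isometry:
  fixes B :: "'e::euclidean_space \<Rightarrow> 'e \<Rightarrow> real"
  assumes B: "bilinear B" and sym: "\<And>v w. B v w = B w v" and pos: "\<And>v. v \<noteq> 0 \<Longrightarrow> B v v > 0"
  shows "\<exists>M :: 'e \<Rightarrow> 'e. linear M \<and> bij M \<and> (\<forall>v w. B v w = M v \<bullet> M w)"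
proof -
  obtain S where S: "finite S" "card S = DIM('e)"
    and orth: "\<And>s t. s \<in> S \<Longrightarrow> t \<in> S \<Longrightarrow> B s t = (if s = t then 1 else 0)"
    using orthonormal_independent_exists[OF assms order.refl] by blast
  obtain h where h: "bij_betw h (Basis :: 'e set) S"
    using finite_same_card_bij[of "Basis :: 'e set" S] S by auto
  define T where "T = (\<lambda>y :: 'e. \<Sum>i\<in>Basis. (y \<bullet> i) *\<^sub>R h i)"
  have linT: "linear T"
    unfolding T_def by (rule linearI) (auto simp: inner_add_left scaleR_add_left sum.distrib scaleR_sum_right)
  have Bh: "B (h i) (h j) = (if i = j then 1 else 0)" if "i \<in> Basis" "j \<in> Basis" for i j
    using h that orth[of "h i" "h j"] by (auto simp: bij_betw_def inj_on_def)
  have BT: "B (T y) (T z) = y \<bullet> z" for y z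
  proof -
    have "B (T y) (T z) = (\<Sum>i\<in>Basis. \<Sum>j\<in>Basis. B ((y \<bullet> i) *\<^sub>R h i) ((z \<bullet> j) *\<^sub>R h j))"
      unfolding T_def using bilinear_sum[OF B] by (simp add: sum.cartesian_product)
    also have "\<dots> = (\<Sum>i\<in>Basis. \<Sum>j\<in>Basis. if i = j then (y \<bullet> i) * (z \<bullet> i) else 0)"
      using B by (intro sum.cong refl) (auto simp: bilinear_lmul bilinear_rmul Bh)
    also have "\<dots> = y \<bullet> z"
      by (simp add: euclidean_inner[of y z])
    finally show ?thesis .
  qed
  have "inj T"
  proof (rule linear_injective_0[OF linT, THEN iffD2], intro allI impI)
    fix y assume "T y = 0"
    then have "y \<bullet> y = 0"
      using BT[of y y] B by (simp add: bilinear_lzero)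
    then show "y = 0"
      by simp
  qed
  moreover have "surj T"
    using linear_injective_imp_surjective[OF linT \<open>inj T\<close>] by simp
  ultimately have "bij T"
    by (simp add: bij_def)
  show ?thesis
  proof (intro exI[of _ "inv T"] conjI allI)
    show "linear (inv T)"
      using linT \<open>inj T\<close> by (rule inj_linear_imp_inv_linear)
    show "bij (inv T)"
      using \<open>bij T\<close> by (rule bij_imp_bij_inv)
    show "B v w = inv T v \<bullet> inv T w" for v w
      using BT[of "inv T v" "inv T w"] \<open>surj T\<close> by (simp add: surj_f_inv_f)
  qed
qed

section \<open>Duality of Randers norms on Euclidean space\<close>

text \<open>In a \<open>g\<close>-orthonormal frame every Randers norm looks like this, with \<open>norm a < 1\<close>. The covector
\<open>legendre_map a y\<close> is the differential of half the squared norm at \<open>y\<close>, so that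
\<open>legendre_map a\<close> is the inverse of the Legendre transform.\<close>

definition randers_norm :: "'e::euclidean_space \<Rightarrow> 'e \<Rightarrow> real" where
  "randers_norm a y = norm y + a \<bullet> y"

definition legendre_map :: "'e::euclidean_space \<Rightarrow> 'e \<Rightarrow> 'e" where
  "legendre_map a y = randers_norm a y *\<^sub>R (sgn y + a)"

lemma norm_scaleR_sgn: "norm y *\<^sub>R sgn y = (y :: 'e::real_normed_vector)"
  by (cases "y = 0") (simp_all add: sgn_div_norm)

lemma randers_norm_pos:
  assumes "norm a < 1" "y \<noteq> 0"
  shows "randers_norm a y > 0"
proof -
  have "norm a * norm y < norm y"
    using assms by simp
  then show ?thesis
    using Cauchy_Schwarz_ineq2[of a y] by (simp add: randers_norm_def)
qed

lemma randers_norm_zero [simp]: "randers_norm a 0 = 0"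
  by (simp add: randers_norm_def)

lemma randers_norm_nonneg: "norm a < 1 \<Longrightarrow> randers_norm a y \<ge> 0"
  using randers_norm_pos[of a y] by (cases "y = 0") auto

lemma randers_norm_scaleR: "c \<ge> 0 \<Longrightarrow> randers_norm a (c *\<^sub>R y) = c * randers_norm a y"
  by (simp add: randers_norm_def algebra_simps)

text \<open>The key to the duality of Randers norms: \<open>randers_norm a\<close> is the support function of the unit ball
around \<open>a\<close>, so that this ball is the dual unit ball, and every nonzero covector is a unique
positive multiple \<open>s\<close> of a point \<open>\<eta> + a\<close> of its boundary. The factor \<open>s\<close> is the dual norm of the
covector. It solves \<open>norm (c - s *\<^sub>R a) = s\<close>, which the intermediate value theorem provides as
\<open>norm a < 1\<close> makes the left-hand side grow more slowly than \<open>s\<close>.\<close>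

lemma covector_polar_exists:
  fixes a c :: "'e::euclidean_space"
  assumes a: "norm a < 1" and c: "c \<noteq> 0"
  obtains s \<eta> where "s > 0" "norm \<eta> = 1" "c = s *\<^sub>R (\<eta> + a)"
proof -
  \<comment> \<open>An upper bound for the root, chosen such that \<open>norm c + K * norm a = K\<close>.\<close>
  define K where "K = norm c / (1 - norm a)"
  have K: "K \<ge> 0" "norm c + K * norm a = K"
    using a by (auto simp: K_def field_simps)
  have "\<exists>s\<ge>0. s \<le> K \<and> norm (c - s *\<^sub>R a) - s = 0"
  proof (rule IVT2)
    have "norm (c - K *\<^sub>R a) \<le> norm c + K * norm a"
      using norm_triangle_ineq4[of c "K *\<^sub>R a"] K by simp
    then show "norm (c - K *\<^sub>R a) - K \<le> 0"
      using K by simp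
  qed (use K in \<open>auto intro!: continuous_intros\<close>)
  then obtain s where s: "s \<ge> 0" "norm (c - s *\<^sub>R a) = s"
    by auto
  have "s > 0"
    using s c by (cases "s = 0") auto
  show ?thesis
  proof
    show "s > 0" by fact
    show "norm ((c - s *\<^sub>R a) /\<^sub>R s) = 1"
      using s \<open>s > 0\<close> by simp
    show "c = s *\<^sub>R ((c - s *\<^sub>R a) /\<^sub>R s + a)"
      using \<open>s > 0\<close> by (simp add: scaleR_add_right)
  qed
qed

lemma covector_polar_le:
  fixes a :: "'e::euclidean_space"
  assumes a: "norm a < 1" and norms: "norm \<eta> = 1" "norm \<eta>' = 1"
    and s: "s \<ge> 0" and eq: "s *\<^sub>R (\<eta> + a) = s' *\<^sub>R (\<eta>' + a)"
  shows "s' \<le> s"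
proof (rule ccontr)
  assume "\<not> s' \<le> s"
  then have less: "s < s'" by simp
  have "s *\<^sub>R \<eta> = s' *\<^sub>R \<eta>' + (s' - s) *\<^sub>R a"
    using eq by (simp add: algebra_simps)
  then have "s' *\<^sub>R \<eta>' = s *\<^sub>R \<eta> - (s' - s) *\<^sub>R a"
    by simp
  then have "norm (s' *\<^sub>R \<eta>') \<le> norm (s *\<^sub>R \<eta>) + norm ((s' - s) *\<^sub>R a)"
    by (metis norm_triangle_ineq4)
  then have "s' \<le> s + (s' - s) * norm a"
    using s less norms by simp
  moreover have "(s' - s) * norm a < (s' - s) * 1"
    using a less by (intro mult_strict_left_mono) auto
  ultimately show False by simp
qed

lemma covector_polar_unique:
  fixes a :: "'e::euclidean_space"
  assumes a: "norm a < 1" and norms: "norm \<eta> = 1" "norm \<eta>' = 1"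
    and s: "s > 0" "s' > 0" and eq: "s *\<^sub>R (\<eta> + a) = s' *\<^sub>R (\<eta>' + a)"
  shows "s' = s" "\<eta>' = \<eta>"
proof -
  show "s' = s"
    using covector_polar_le[OF a norms, of s s'] covector_polar_le[OF a norms(2,1), of s' s] s eq
    by simp
  then show "\<eta>' = \<eta>"
    using eq s by simp
qed

text \<open>The vector that the Legendre transform assigns to \<open>s *\<^sub>R (\<eta> + a)\<close>: it has direction \<open>\<eta>\<close> and
Randers norm \<open>s\<close>.\<close>

lemma randers_norm_direction:
  fixes a :: "'e::euclidean_space"
  assumes a: "norm a < 1" and \<eta>: "norm \<eta> = 1" and s: "s > 0"
  defines "y \<equiv> (s / (1 + a \<bullet> \<eta>)) *\<^sub>R \<eta>"
  shows "y \<noteq> 0" "sgn y = \<eta>" "randers_norm a y = s"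
proof -
  have "\<eta> \<noteq> 0" using \<eta> by auto
  then have "1 + a \<bullet> \<eta> > 0"
    using randers_norm_pos[OF a, of \<eta>] \<eta> by (simp add: randers_norm_def)
  then have pos: "s / (1 + a \<bullet> \<eta>) > 0"
    using s by simp
  show "y \<noteq> 0"
    unfolding y_def using pos \<open>\<eta> \<noteq> 0\<close> by (metis less_irrefl scaleR_eq_0_iff)
  show "sgn y = \<eta>"
    unfolding y_def sgn_scaleR sgn_pos[OF pos] by (simp add: \<eta> sgn_div_norm)
  have "randers_norm a y = s / (1 + a \<bullet> \<eta>) * randers_norm a \<eta>"
    unfolding y_def using pos by (intro randers_norm_scaleR) simp
  also have "randers_norm a \<eta> = 1 + a \<bullet> \<eta>"
    by (simp add: randers_norm_def \<eta>)
  finally show "randers_norm a y = s"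
    using \<open>1 + a \<bullet> \<eta> > 0\<close> by simp
qed

lemma randers_norm_sgn:
  "randers_norm a y = norm y * (1 + a \<bullet> sgn y)"
  by (cases "y = 0") (simp_all add: randers_norm_def sgn_div_norm field_simps)

lemma eq_if_same_direction:
  fixes a :: "'e::euclidean_space"
  assumes a: "norm a < 1" and y: "y \<noteq> 0" "randers_norm a y = randers_norm a y'" "sgn y = sgn y'"
  shows "y = y'"
proof -
  have "1 + a \<bullet> sgn y > 0"
    using randers_norm_pos[OF a y(1)] by (simp add: randers_norm_sgn zero_less_mult_iff y(1))
  then have "norm y = norm y'"
    using y(2,3) by (simp add: randers_norm_sgn)
  then have "norm y *\<^sub>R sgn y = norm y' *\<^sub>R sgn y'"
    using y(3) by simp
  then show ?thesis
    by (simp only: norm_scaleR_sgn)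
qed

text \<open>By uniqueness of the polar decomposition, \<open>legendre_map a y\<close> determines the Randers norm and the
direction of \<open>y\<close>, hence \<open>y\<close>.\<close>

lemma inj_on_legendre_map:
  fixes a :: "'e::euclidean_space"
  assumes a: "norm a < 1"
  shows "inj_on (legendre_map a) (- {0})"
proof (rule inj_onI)
  fix y y' assume y: "y \<in> - {0}" "y' \<in> - {0}" and eq: "legendre_map a y = legendre_map a y'"
  have norms: "norm (sgn y) = 1" "norm (sgn y') = 1"
    using y by (simp_all add: norm_sgn)
  have pos: "randers_norm a y > 0" "randers_norm a y' > 0"
    using y randers_norm_pos[OF a] by simp_all
  note * = covector_polar_unique[OF a norms pos eq[unfolded legendre_map_def]]
  show "y = y'"
    by (rule eq_if_same_direction[OF a]) (use y * in simp_all)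
qed

text \<open>The Legendre map sends the unit ball to the dual unit ball, which is the Euclidean ball around \<open>a\<close>.
The origin has to be removed on both sides, because \<open>legendre_map a\<close> is in general not
differentiable there.\<close>

lemma legendre_map_image:
  fixes a :: "'e::euclidean_space"
  assumes a: "norm a < 1"
  shows "legendre_map a ` ({y. randers_norm a y < 1} - {0}) = ball a 1 - {0}"
proof (intro set_eqI iffI)
  fix c assume "c \<in> legendre_map a ` ({y. randers_norm a y < 1} - {0})"
  then obtain y where y: "y \<noteq> 0" "randers_norm a y < 1" and c: "c = legendre_map a y"
    by auto
  define s where "s = randers_norm a y"
  have s: "s > 0" "s < 1"
    using randers_norm_pos[OF a] y by (auto simp: s_def)
  have c': "c = s *\<^sub>R (sgn y + a)"
    by (simp add: c legendre_map_def s_def)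
  have "norm (s *\<^sub>R sgn y - (1 - s) *\<^sub>R a) \<le> s + (1 - s) * norm a"
    using norm_triangle_ineq4[of "s *\<^sub>R sgn y" "(1 - s) *\<^sub>R a"] s y by (simp add: norm_sgn)
  also have "\<dots> < s + (1 - s) * 1"
    using s a by (intro add_strict_left_mono mult_strict_left_mono) auto
  finally have "norm (c - a) < 1"
    by (simp add: c' algebra_simps)
  moreover have "c \<noteq> 0"
  proof
    assume "c = 0"
    then have "sgn y = - a"
      using s c' by (simp add: eq_neg_iff_add_eq_0)
    then have "norm a = 1"
      using y by (metis norm_minus_cancel norm_sgn)
    then show False using a by simp
  qed
  ultimately show "c \<in> ball a 1 - {0}"
    by (simp add: dist_norm norm_minus_commute)
next
  fix c assume c: "c \<in> ball a 1 - {0}"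
  obtain s \<eta> where s: "s > 0" and \<eta>: "norm \<eta> = 1" and polar: "c = s *\<^sub>R (\<eta> + a)"
    using covector_polar_exists[OF a, of c] c by auto
  have "s < 1"
  proof (rule ccontr)
    assume "\<not> s < 1"
    then have "s \<ge> 1" by simp
    have "s *\<^sub>R \<eta> = (c - a) - (s - 1) *\<^sub>R a"
      by (simp add: polar algebra_simps)
    then have "norm (s *\<^sub>R \<eta>) \<le> norm (c - a) + norm ((s - 1) *\<^sub>R a)"
      by (metis norm_triangle_ineq4)
    then have "s \<le> norm (c - a) + (s - 1) * norm a"
      using s \<eta> \<open>s \<ge> 1\<close> by simp
    also have "\<dots> < 1 + (s - 1) * 1"
      using c a \<open>s \<ge> 1\<close> by (intro add_less_le_mono mult_left_mono)
        (auto simp: dist_norm norm_minus_commute)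
    finally show False by simp
  qed
  define y where "y = (s / (1 + a \<bullet> \<eta>)) *\<^sub>R \<eta>"
  note y = randers_norm_direction[OF a \<eta> s, folded y_def]
  have "c = legendre_map a y"
    by (simp add: legendre_map_def y polar)
  then show "c \<in> legendre_map a ` ({y. randers_norm a y < 1} - {0})"
    by (rule image_eqI) (use y \<open>s < 1\<close> in simp_all)
qed

lemma legendre_map_inner_le:
  fixes a :: "'e::euclidean_space"
  assumes "norm \<eta> = 1"
  shows "(\<eta> + a) \<bullet> y \<le> randers_norm a y"
  using norm_cauchy_schwarz[of \<eta> y] assms by (simp add: randers_norm_def inner_add_left)

lemma legendre_map_inner_eqD:
  fixes a :: "'e::euclidean_space"
  assumes \<eta>: "norm \<eta> = 1" and eq: "(\<eta> + a) \<bullet> y = randers_norm a y" and y: "y \<noteq> 0"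
  shows "sgn y = \<eta>"
proof -
  have "\<eta> \<bullet> y = norm \<eta> * norm y"
    using eq \<eta> by (simp add: randers_norm_def inner_add_left)
  then have "norm y *\<^sub>R \<eta> = y"
    unfolding norm_cauchy_schwarz_eq using \<eta> by simp
  then have "norm y *\<^sub>R \<eta> = norm y *\<^sub>R sgn y"
    by (simp add: norm_scaleR_sgn)
  then show ?thesis
    using y by simp
qed

text \<open>For \<open>c = s *\<^sub>R (\<eta> + a)\<close> the functional is at most \<open>s * r - r\<^sup>2 / 2\<close> with \<open>r = randers_norm a z\<close>, and this
is at most \<open>s\<^sup>2 / 2\<close>. Equality forces \<open>r = s\<close> and equality in the Cauchy--Schwarz inequality
between \<open>z\<close> and \<open>\<eta>\<close>, so the maximizer is unique. The last two conclusions say that its Randers norm is the dual norm of \<open>c\<close>.\<close>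

lemma randers_maximizer:
  fixes a c :: "'e::euclidean_space"
  assumes a: "norm a < 1"
  obtains y where
    "\<And>z. c \<bullet> z - (randers_norm a z)\<^sup>2 / 2 \<le> c \<bullet> y - (randers_norm a y)\<^sup>2 / 2"
    "\<And>z. c \<bullet> z - (randers_norm a z)\<^sup>2 / 2 = c \<bullet> y - (randers_norm a y)\<^sup>2 / 2 \<Longrightarrow> z = y"
    "\<And>z. c \<bullet> z \<le> randers_norm a y * randers_norm a z"
    "c \<bullet> y = (randers_norm a y)\<^sup>2"
proof (cases "c = 0")
  case True
  show ?thesis
  proof (rule that[of 0])
    fix z
    assume "c \<bullet> z - (randers_norm a z)\<^sup>2 / 2 = c \<bullet> 0 - (randers_norm a 0)\<^sup>2 / 2"
    then have "randers_norm a z = 0"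
      by (simp add: True)
    then show "z = 0"
      using randers_norm_pos[OF a, of z] by auto
  qed (simp_all add: True)
next
  case False
  then obtain s \<eta> where s: "s > 0" and \<eta>: "norm \<eta> = 1" and c: "c = s *\<^sub>R (\<eta> + a)"
    using covector_polar_exists[OF a] by blast
  define y where "y = (s / (1 + a \<bullet> \<eta>)) *\<^sub>R \<eta>"
  note y = randers_norm_direction[OF a \<eta> s, folded y_def]
  have le: "c \<bullet> z \<le> s * randers_norm a z" for z
    using mult_left_mono[OF legendre_map_inner_le[OF \<eta>], of s a z] s by (simp add: c)
  have "y = norm y *\<^sub>R \<eta>"
    using norm_scaleR_sgn[of y] y by simp
  then have "\<eta> \<bullet> y = norm y * (\<eta> \<bullet> \<eta>)"
    by (metis inner_scaleR_right)
  then have "\<eta> \<bullet> y = norm y"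
    using \<eta> by (simp add: norm_eq_1)
  then have cy: "c \<bullet> y = s\<^sup>2"
    using y(3) by (simp add: c inner_add_left randers_norm_def power2_eq_square)
  have gap: "s * r - r\<^sup>2 / 2 = s\<^sup>2 / 2 - (s - r)\<^sup>2 / 2" for r :: real
    by (simp add: power2_eq_square field_simps)
  show ?thesis
  proof (rule that[of y])
    fix z
    show "c \<bullet> z \<le> randers_norm a y * randers_norm a z"
      using le y by simp
    have "c \<bullet> z - (randers_norm a z)\<^sup>2 / 2 \<le> s\<^sup>2 / 2 - (s - randers_norm a z)\<^sup>2 / 2"
      using le[of z] gap[of "randers_norm a z"] by linarith
    also have "\<dots> \<le> s\<^sup>2 / 2" by simp
    finally show "c \<bullet> z - (randers_norm a z)\<^sup>2 / 2 \<le> c \<bullet> y - (randers_norm a y)\<^sup>2 / 2"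
      by (simp add: cy y)
    assume "c \<bullet> z - (randers_norm a z)\<^sup>2 / 2 = c \<bullet> y - (randers_norm a y)\<^sup>2 / 2"
    then have max: "c \<bullet> z - (randers_norm a z)\<^sup>2 / 2 = s\<^sup>2 / 2"
      by (simp add: cy y)
    then have "(s - randers_norm a z)\<^sup>2 \<le> 0"
      using le[of z] gap[of "randers_norm a z"] by linarith
    then have Fz: "randers_norm a z = s" by simp
    then have "c \<bullet> z = s * randers_norm a z"
      using max by (simp add: power2_eq_square)
    then have "(\<eta> + a) \<bullet> z = randers_norm a z"
      using s by (simp add: c)
    moreover have "z \<noteq> 0"
      using Fz s by auto
    ultimately have "sgn z = \<eta>"
      by (rule legendre_map_inner_eqD[OF \<eta>])
    then show "z = y"
      using \<open>z \<noteq> 0\<close> Fz y eq_if_same_direction[OF a, of z y] by simp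
  qed (simp add: cy y)
qed

section \<open>The volume of the dual unit ball\<close>

text \<open>The derivative of \<open>legendre_map a\<close>, that is, the fundamental tensor as an endomorphism: the rank-one
square of the differential of the norm plus a multiple of the projection orthogonal to \<open>y\<close>.\<close>

definition legendre_deriv :: "'e::euclidean_space \<Rightarrow> 'e \<Rightarrow> 'e \<Rightarrow> 'e" where
  "legendre_deriv a y h = ((sgn y + a) \<bullet> h) *\<^sub>R (sgn y + a) +
     (randers_norm a y / norm y) *\<^sub>R (h - (sgn y \<bullet> h) *\<^sub>R sgn y)"

lemma has_derivative_randers_norm:
  assumes "y \<noteq> 0"
  shows "(randers_norm a has_derivative (\<lambda>h. (sgn y + a) \<bullet> h)) (at y)"
proof -
  have "((\<lambda>y. norm y + a \<bullet> y) has_derivative (\<lambda>h. h \<bullet> sgn y + a \<bullet> h)) (at y)"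
    by (intro has_derivative_add has_derivative_norm[OF assms] has_derivative_inner_right has_derivative_ident)
  then show ?thesis
    by (simp add: randers_norm_def[abs_def] inner_add_right inner_commute)
qed

lemma has_derivative_sgn:
  fixes y :: "'e::euclidean_space"
  assumes "y \<noteq> 0"
  shows "(sgn has_derivative (\<lambda>h. (h - (sgn y \<bullet> h) *\<^sub>R sgn y) /\<^sub>R norm y)) (at y)"
proof -
  have "((\<lambda>y. inverse (norm y) *\<^sub>R y) has_derivative
      (\<lambda>h. inverse (norm y) *\<^sub>R h + (- (inverse (norm y) * (h \<bullet> sgn y) * inverse (norm y))) *\<^sub>R y)) (at y)"
    using assms by (intro derivative_intros has_derivative_norm) auto
  then show ?thesis
    unfolding sgn_div_norm[abs_def] using assms
    by (rule_tac has_derivative_eq_rhs) (auto simp: fun_eq_iff algebra_simps inner_commute)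
qed

lemma has_derivative_legendre_map:
  assumes "y \<noteq> 0"
  shows "(legendre_map a has_derivative legendre_deriv a y) (at y)"
proof -
  have "((\<lambda>y. randers_norm a y *\<^sub>R (sgn y + a)) has_derivative
      (\<lambda>h. randers_norm a y *\<^sub>R ((h - (sgn y \<bullet> h) *\<^sub>R sgn y) /\<^sub>R norm y + 0) +
           ((sgn y + a) \<bullet> h) *\<^sub>R (sgn y + a))) (at y)"
    by (intro derivative_intros has_derivative_randers_norm has_derivative_sgn assms)
  then show ?thesis
    unfolding legendre_map_def[abs_def]
    by (rule has_derivative_eq_rhs) (simp add: fun_eq_iff legendre_deriv_def divide_inverse)
qed

lemma has_derivative_randers_norm_square:
  assumes "y \<noteq> 0"
  shows "((\<lambda>y. (randers_norm a y)\<^sup>2) has_derivative (\<lambda>h. 2 * (legendre_map a y \<bullet> h))) (at y)"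
proof -
  have "((\<lambda>y. (randers_norm a y)\<^sup>2) has_derivative
      (\<lambda>h. of_nat 2 * ((sgn y + a) \<bullet> h) * randers_norm a y ^ (2 - 1))) (at y)"
    by (rule has_derivative_power) (rule has_derivative_randers_norm[OF assms])
  then show ?thesis
    by (rule has_derivative_eq_rhs) (simp add: legendre_map_def fun_eq_iff mult_ac)
qed

lemma legendre_deriv_nonneg:
  assumes "norm a < 1"
  shows "h \<bullet> legendre_deriv a y h \<ge> 0"
proof -
  have "(sgn y \<bullet> h)\<^sup>2 \<le> (norm (sgn y) * norm h)\<^sup>2"
    unfolding abs_le_square_iff[symmetric] using Cauchy_Schwarz_ineq2[of "sgn y" h] by (simp add: abs_mult)
  also have "\<dots> \<le> h \<bullet> h"
    by (simp add: norm_sgn power2_norm_eq_inner)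
  finally have "h \<bullet> h - (sgn y \<bullet> h)\<^sup>2 \<ge> 0"
    by simp
  then have "randers_norm a y / norm y * (h \<bullet> h - (sgn y \<bullet> h)\<^sup>2) \<ge> 0"
    using randers_norm_nonneg[OF assms, of y] by simp
  moreover have "h \<bullet> legendre_deriv a y h =
      ((sgn y + a) \<bullet> h)\<^sup>2 + randers_norm a y / norm y * (h \<bullet> h - (sgn y \<bullet> h)\<^sup>2)"
    by (simp add: legendre_deriv_def inner_add_right inner_diff_right inner_commute power2_eq_square)
  ultimately show ?thesis
    by simp
qed

lemma linear_legendre_deriv: "linear (legendre_deriv a y)"
  unfolding legendre_deriv_def[abs_def]
  by (intro bounded_linear.linear bounded_linear_intros)

text \<open>The segment from the identity to \<open>A\<close> consists, up to its end point, of positive definite matrices.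
A negative determinant at the end would give a singular one before it.\<close>

lemma det_nonneg_if_semidefinite:
  fixes A :: "real ^ 'n ^ 'n"
  assumes A: "\<And>x. x \<bullet> (A *v x) \<ge> 0"
  shows "det A \<ge> 0"
proof (rule ccontr)
  assume "\<not> det A \<ge> 0"
  define P where "P = (\<lambda>t :: real. (1 - t) *\<^sub>R mat 1 + t *\<^sub>R A)"
  have cont: "continuous_on {0..1} (\<lambda>t. det (P t))"
    unfolding det_def P_def by (intro continuous_intros)
  have "P 0 = mat 1" "P 1 = A"
    by (simp_all add: P_def)
  then have "\<exists>t\<ge>0. t \<le> 1 \<and> det (P t) = 0"
    using \<open>\<not> det A \<ge> 0\<close> cont by (intro IVT2') auto
  then obtain t where t: "0 \<le> t" "t \<le> 1" "det (P t) = 0"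
    by blast
  have "t \<noteq> 1"
    using t \<open>P 1 = A\<close> \<open>\<not> det A \<ge> 0\<close> by auto
  have "\<not> invertible (P t)"
    using t by (simp add: invertible_det_nz)
  then obtain x where x: "x \<noteq> 0" "P t *v x = 0"
    unfolding invertible_left_inverse matrix_left_invertible_ker by blast
  have "P t *v x = (1 - t) *\<^sub>R x + t *\<^sub>R (A *v x)"
    by (simp add: P_def matrix_vector_mult_add_rdistrib scaleR_matrix_vector_assoc[symmetric])
  then have "x \<bullet> (P t *v x) = (1 - t) * (x \<bullet> x) + t * (x \<bullet> (A *v x))"
    by (simp only: inner_add_right inner_scaleR_right)
  moreover have "(1 - t) * (x \<bullet> x) > 0"
    using t \<open>t \<noteq> 1\<close> x by simp
  moreover have "t * (x \<bullet> (A *v x)) \<ge> 0"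
    using t A by simp
  ultimately have "x \<bullet> (P t *v x) > 0"
    by linarith
  then show False
    by (simp add: x)
qed

lemma measurable_det_matrix:
  fixes f' :: "'c \<Rightarrow> real ^ 'n \<Rightarrow> real ^ 'n"
  assumes "\<And>h. (\<lambda>x. f' x h) \<in> borel_measurable M"
  shows "(\<lambda>x. det (matrix (f' x))) \<in> borel_measurable M"
proof -
  have [measurable]: "(\<lambda>x. f' x h $ i) \<in> borel_measurable M" for h i
    using assms[of h] borel_measurable_continuous_onI[of "\<lambda>v. v $ i"]
    by (rule measurable_compose) (intro continuous_intros)
  show ?thesis
    unfolding det_def matrix_def by simp
qed

lemma borel_measurable_legendre_deriv [measurable]:
  fixes a :: "'e::euclidean_space"
  assumes [measurable]: "f \<in> borel_measurable M"
  shows "(\<lambda>x. legendre_deriv a (f x) h) \<in> borel_measurable M"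
  unfolding legendre_deriv_def randers_norm_def sgn_div_norm by measurable

text \<open>The geometric content of the Holmes--Thompson volume. In coordinates, the determinant of the
fundamental tensor is the Jacobian of the Legendre map \<open>\<Psi>\<close>, so its integral over the unit ball is
the volume of the dual unit ball. That is a translate of the dual unit ball of the Riemannian
metric alone, whose volume does not see \<open>a\<close>. The determinant enters without absolute value;
it is the absolute value because the fundamental tensor is positive semidefinite. The hypothesis on
\<open>D\<close> leaves out the origin, where the fundamental tensor has no meaningful value.\<close>

lemma integral_det_legendre:
  fixes N :: "real ^ 'n \<Rightarrow> real ^ 'n"
  assumes a: "norm a < 1" and N: "linear N" "bij N"
    and D: "\<And>u. u \<noteq> 0 \<Longrightarrow> D u = det (matrix (\<lambda>h. adjoint N (legendre_deriv a (N u) (N h))))"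
  shows "(LINT u : {u. randers_norm a (N u) < 1} | lborel. D u) =
    \<bar>det (matrix N)\<bar> * measure lborel (ball (0 :: real ^ 'n) 1)"
proof -
  define T where "T = adjoint N"
  define \<Psi> where "\<Psi> = (\<lambda>u. T (legendre_map a (N u)))"
  define \<Psi>' where "\<Psi>' = (\<lambda>u h. T (legendre_deriv a (N u) (N h)))"
  define U where "U = {u. randers_norm a (N u) < 1}"
  define V where "V = ball a 1 - {0}"
  have N0: "N u = 0 \<longleftrightarrow> u = 0" for u
    using linear_injective_0[OF N(1)] bij_is_inj[OF N(2)] linear_0[OF N(1)] by auto
  have linT: "linear T"
    unfolding T_def using N(1) by (rule adjoint_linear)
  have detT: "det (matrix T) = det (matrix N)"
    unfolding T_def by (simp add: matrix_adjoint[OF N(1)])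
  have "inj T"
  proof (rule linear_injective_0[OF linT, THEN iffD2], intro allI impI)
    fix w assume "T w = 0"
    obtain u where u: "w = N u"
      using surjD[OF bij_is_surj[OF N(2)]] by blast
    have "w \<bullet> w = u \<bullet> T w"
      unfolding T_def using adjoint_works[OF N(1), of u w] u by simp
    then show "w = 0"
      using \<open>T w = 0\<close> by simp
  qed
  have "surj T"
    using linear_injective_imp_surjective[OF linT \<open>inj T\<close>] by simp
  have contN: "continuous_on UNIV N"
    using N by (simp add: linear_continuous_on linear_conv_bounded_linear)
  have contF: "continuous_on UNIV (\<lambda>u. randers_norm a (N u))"
    unfolding randers_norm_def by (intro continuous_intros continuous_on_subset[OF contN]) auto
  have openU: "open U"
    unfolding U_def using contF by (simp add: open_Collect_less)
  have [measurable]: "N \<in> borel_measurable borel" "T \<in> borel_measurable borel"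
    using N linT by (auto intro!: borel_measurable_continuous_onI linear_continuous_on
      simp: linear_conv_bounded_linear)
  have meas: "(\<lambda>u. det (matrix (\<Psi>' u))) \<in> borel_measurable borel"
    unfolding \<Psi>'_def by (rule measurable_det_matrix) measurable
  have nonneg: "det (matrix (\<Psi>' u)) \<ge> 0" for u
  proof (rule det_nonneg_if_semidefinite)
    fix h
    have lin: "linear (\<Psi>' u)"
      unfolding \<Psi>'_def using linear_compose[OF linear_compose[OF N(1) linear_legendre_deriv] linT]
      by (simp add: o_def)
    have "h \<bullet> \<Psi>' u h = N h \<bullet> legendre_deriv a (N u) (N h)"
      unfolding \<Psi>'_def T_def by (simp add: adjoint_works[OF N(1)])
    then show "h \<bullet> (matrix (\<Psi>' u) *v h) \<ge> 0"
      using legendre_deriv_nonneg[OF a] by (simp add: matrix_works linear_matrix_vector_mul_eq lin)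
  qed
  have der: "(\<Psi> has_derivative \<Psi>' u) (at u)" if "u \<noteq> 0" for u
  proof -
    have "((legendre_map a \<circ> N) has_derivative (legendre_deriv a (N u) \<circ> N)) (at u)"
      using that N by (intro diff_chain_at has_derivative_legendre_map linear_imp_has_derivative) (simp_all add: N0)
    then have "((T \<circ> (legendre_map a \<circ> N)) has_derivative (T \<circ> (legendre_deriv a (N u) \<circ> N))) (at u)"
      by (rule diff_chain_at) (rule linear_imp_has_derivative[OF linT])
    then show ?thesis
      by (simp add: \<Psi>_def \<Psi>'_def o_def)
  qed
  have "U - {0} = N -` ({y. randers_norm a y < 1} - {0})"
    by (auto simp: U_def N0)
  then have "N ` (U - {0}) = {y. randers_norm a y < 1} - {0}"
    using bij_is_surj[OF N(2)] by (simp add: surj_image_vimage_eq)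
  then have "T ` V = T ` legendre_map a ` N ` (U - {0})"
    by (simp only: V_def legendre_map_image[OF a])
  then have image: "\<Psi> ` (U - {0}) = T ` V"
    by (simp add: \<Psi>_def image_image)
  have inj: "inj_on \<Psi> (U - {0})"
  proof (rule inj_onI)
    fix u v assume uv: "u \<in> U - {0}" "v \<in> U - {0}" and "\<Psi> u = \<Psi> v"
    then have "legendre_map a (N u) = legendre_map a (N v)"
      using injD[OF \<open>inj T\<close>] by (simp add: \<Psi>_def)
    then have "N u = N v"
      by (rule inj_onD[OF inj_on_legendre_map[OF a]]) (use uv in \<open>simp_all add: N0\<close>)
    then show "u = v"
      by (rule injD[OF bij_is_inj[OF N(2)]])
  qed
  have "open V"
    unfolding V_def by (intro open_Diff) auto
  then have "open (T ` V)"
    using linT \<open>surj T\<close> by (rule open_surjective_linear_image)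
  moreover have "bounded (T ` V)"
    using linT unfolding V_def
    by (intro bounded_linear_image bounded_diff) (auto simp: linear_conv_bounded_linear)
  ultimately have TV: "T ` V \<in> sets borel" "emeasure lborel (T ` V) < \<infinity>"
    using emeasure_bounded_finite by auto
  have "measure lborel (T ` V) = (LINT x : V | lborel. \<bar>det (matrix T)\<bar>)"
    using TV \<open>inj T\<close> linT \<open>open V\<close>
    by (intro set_integral_abs_jacobian[symmetric] linear_imp_has_derivative)
      (auto intro: inj_on_subset)
  also have "\<dots> = \<bar>det (matrix N)\<bar> * measure lborel V"
    using \<open>open V\<close> by (simp add: set_lebesgue_integral_def detT)
  also have "measure lborel V = measure lborel (ball a 1)"
    unfolding V_def by (subst measure_Diff_null_set) (auto simp: null_sets_def)
  also have "\<dots> = measure lborel (ball (0 :: real ^ 'n) 1)"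
    by (simp add: content_ball)
  finally have TV_measure: "measure lborel (T ` V) =
    \<bar>det (matrix N)\<bar> * measure lborel (ball (0 :: real ^ 'n) 1)" .
  have abs_D: "D u = \<bar>det (matrix (\<Psi>' u))\<bar>" if "u \<noteq> 0" for u
    using D[OF that] nonneg[of u] by (simp add: \<Psi>'_def T_def)
  have "(LINT u : U | lborel. D u) = (LINT u : U - {0} | lborel. \<bar>det (matrix (\<Psi>' u))\<bar>)"
    unfolding set_lebesgue_integral_def
    by (rule integral_discrete_difference[of "{0}"])
      (auto simp: abs_D indicator_def)
  also have "\<dots> = measure lborel (\<Psi> ` (U - {0}))"
  proof (rule set_integral_abs_jacobian)
    show "U - {0} \<in> sets borel"
      using openU by auto
    then show "(\<lambda>u. indicator (U - {0}) u * \<bar>det (matrix (\<Psi>' u))\<bar>) \<in> borel_measurable borel"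
      using meas by measurable
  qed (use der inj TV image in auto)
  finally show ?thesis
    unfolding image TV_measure by (simp only: U_def)
qed

section \<open>Tangent spaces in charts\<close>

lemma smooth_on_imp_differentiable:
  "smooth_on f S \<Longrightarrow> x \<in> S \<Longrightarrow> f differentiable (at x)"
  unfolding smooth_on_def by (metis Ck_on.simps(2))

lemma chart_at:
  assumes "smooth_atlas A"
  shows "chart_at A x \<in> A" "x \<in> fst (chart_at A x)"
proof -
  have "\<exists>c. c \<in> A \<and> x \<in> fst c"
    using assms unfolding smooth_atlas_def by blast
  then have "chart_at A x \<in> A \<and> x \<in> fst (chart_at A x)"
    unfolding chart_at_def by (rule someI_ex)
  then show "chart_at A x \<in> A" "x \<in> fst (chart_at A x)"
    by auto
qed

lemma coord_inv_coord:
  assumes "is_chart c" "x \<in> fst c"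
  shows "coord_inv c (snd c x) = x"
  using assms unfolding is_chart_def homeomorphism_def by auto

lemma linear_differential:
  assumes A: "smooth_atlas A" and f: "smooth_fun A f"
  shows "linear (differential A f x)"
proof -
  define c where "c = chart_at A x"
  have c: "c \<in> A" "x \<in> fst c"
    unfolding c_def using chart_at[OF A] by auto
  then have "smooth_on (f \<circ> coord_inv c) (coord_image c)"
    using f by (simp add: smooth_fun_def)
  moreover have "snd c x \<in> coord_image c"
    using c by (simp add: coord_image_def)
  ultimately have "(f \<circ> coord_inv c) differentiable (at (snd c x))"
    by (rule smooth_on_imp_differentiable)
  then show ?thesis
    unfolding differential_def[abs_def] c_def[symmetric] by (rule linear_frechet_derivative)
qed

lemma open_coord_overlap:
  assumes c: "is_chart c" and d: "is_chart d"
  shows "open (snd c ` (fst c \<inter> fst d))"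
proof -
  have hom: "homeomorphism (fst c) (coord_image c) (snd c) (coord_inv c)"
    using c by (simp add: is_chart_def)
  have "snd c ` (fst c \<inter> fst d) = coord_image c \<inter> coord_inv c -` fst d"
    using coord_inv_coord[OF c] by (auto simp: coord_image_def)
  moreover have "open (coord_image c \<inter> coord_inv c -` fst d)"
    using hom c d by (intro continuous_open_preimage) (auto simp: homeomorphism_def is_chart_def)
  ultimately show ?thesis
    by simp
qed

text \<open>The transition map back to the chart \<open>c\<close> is a local inverse, so the chain rule makes its derivative
an inverse of \<open>tangent_of A c x\<close>.\<close>

lemma tangent_of_isomorphism:
  assumes A: "smooth_atlas A" and c: "c \<in> A" and x: "x \<in> fst c"
  shows "linear (tangent_of A c x)" "bij (tangent_of A c x)"
proof -
  define d where "d = chart_at A x"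
  have d: "d \<in> A" "x \<in> fst d"
    unfolding d_def using chart_at[OF A] by auto
  have charts: "is_chart c" "is_chart d"
    using A c d by (auto simp: smooth_atlas_def)
  define \<tau> where "\<tau> = snd d \<circ> coord_inv c"
  define \<sigma> where "\<sigma> = snd c \<circ> coord_inv d"
  define U where "U = snd c ` (fst c \<inter> fst d)"
  define L where "L = frechet_derivative \<tau> (at (snd c x))"
  define K where "K = frechet_derivative \<sigma> (at (snd d x))"
  have smooth: "smooth_on \<tau> U" "smooth_on \<sigma> (snd d ` (fst d \<inter> fst c))"
    unfolding \<tau>_def \<sigma>_def U_def using A c d by (auto simp: smooth_atlas_def)
  have \<tau>x: "\<tau> (snd c x) = snd d x"
    using charts x by (simp add: \<tau>_def coord_inv_coord)
  have "\<tau> differentiable (at (snd c x))" "\<sigma> differentiable (at (snd d x))"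
    using smooth x d by (auto intro!: smooth_on_imp_differentiable simp: U_def)
  then have der: "(\<tau> has_derivative L) (at (snd c x))" "(\<sigma> has_derivative K) (at (\<tau> (snd c x)))"
    by (simp_all add: L_def K_def \<tau>x frechet_derivative_works)
  have "((\<sigma> \<circ> \<tau>) has_derivative (K \<circ> L)) (at (snd c x))"
    using der by (rule diff_chain_at)
  moreover have "open U"
    unfolding U_def using charts by (rule open_coord_overlap)
  moreover have "snd c x \<in> U"
    using x d by (simp add: U_def)
  moreover have "(\<sigma> \<circ> \<tau>) y = y" if "y \<in> U" for y
    using that charts by (auto simp: U_def \<sigma>_def \<tau>_def coord_inv_coord)
  ultimately have "((\<lambda>y. y) has_derivative (K \<circ> L)) (at (snd c x))"
    by (rule has_derivative_transform_within_open)
  then have "K \<circ> L = (\<lambda>h. h)"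
    using has_derivative_ident by (rule has_derivative_unique)
  then have "inj L"
    by (intro inj_on_inverseI[of _ K]) (simp add: fun_eq_iff)
  have "linear L"
    using der has_derivative_linear by blast
  have "tangent_of A c x = L"
    by (simp add: fun_eq_iff tangent_of_def L_def \<tau>_def d_def)
  moreover have "bij L"
    using linear_injective_imp_surjective[OF \<open>linear L\<close> \<open>inj L\<close>] \<open>inj L\<close> by (simp add: bij_def)
  ultimately show "linear (tangent_of A c x)" "bij (tangent_of A c x)"
    using \<open>linear L\<close> by simp_all
qed

section \<open>The Holmes--Thompson measure of a Randers metric\<close>

text \<open>A \<open>g\<close>-orthonormal frame at \<open>x\<close> turns the Randers norm into \<open>randers_norm a\<close>. Evaluating \<open>\<beta>\<close> at the unit
vector in the direction of \<open>a\<close> shows that \<open>norm a\<close> is at most the \<open>g\<close>-norm of \<open>\<beta>\<close>.\<close>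

lemma randers_frame:
  fixes g :: "'a \<Rightarrow> real ^ 'n \<Rightarrow> real ^ 'n \<Rightarrow> real"
  assumes R: "randers_data A g \<beta>"
  shows "\<exists>(M :: real ^ 'n \<Rightarrow> real ^ 'n) a. linear M \<and> bij M \<and> norm a < 1 \<and>
    (\<forall>v w. g x v w = M v \<bullet> M w) \<and> (\<forall>v. \<beta> x v = a \<bullet> M v)"
proof -
  have g: "bilinear (g x)" "\<And>v w. g x v w = g x w v" "\<And>v. v \<noteq> 0 \<Longrightarrow> g x v v > 0"
    using R by (auto simp: randers_data_def riemannian_metric_def)
  have \<beta>: "linear (\<beta> x)"
    using R by (simp add: randers_data_def one_form_def)
  have "\<exists>M :: real ^ 'n \<Rightarrow> real ^ 'n. linear M \<and> bij M \<and> (\<forall>v w. g x v w = M v \<bullet> M w)"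
    by (rule positive_definite_isometry) (use g in auto)
  then obtain M :: "real ^ 'n \<Rightarrow> real ^ 'n" where M: "linear M" "bij M" and "\<forall>v w. g x v w = M v \<bullet> M w"
    by blast
  then have gM: "g x v w = M v \<bullet> M w" for v w
    by simp
  have invM: "linear (inv M)"
    using M by (simp add: bij_is_inj inj_linear_imp_inv_linear)
  \<comment> \<open>The adjoint at \<open>1\<close> is the vector that represents a linear form.\<close>
  define a where "a = adjoint (\<beta> x \<circ> inv M) 1"
  have "linear (\<beta> x \<circ> inv M)"
    using invM \<beta> by (rule linear_compose)
  then have "(\<beta> x \<circ> inv M) y = a \<bullet> y" for y
    using adjoint_works[of "\<beta> x \<circ> inv M" y 1] by (simp add: a_def inner_commute)
  then have \<beta>M: "\<beta> x v = a \<bullet> M v" for v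
    using M \<open>\<And>y. (\<beta> x \<circ> inv M) y = a \<bullet> y\<close>[of "M v"] by (simp add: bij_is_inj)
  have "norm a < 1"
  proof (cases "a = 0")
    case False
    define v where "v = inv M (sgn a)"
    have Mv: "M v = sgn a"
      using M by (simp add: v_def bij_is_surj surj_f_inv_f)
    have bdd: "bdd_above (\<beta> x ` {v. riemannian_norm g x v \<le> 1})"
    proof (rule bdd_aboveI2)
      fix v assume "v \<in> {v. riemannian_norm g x v \<le> 1}"
      then have "norm (M v) \<le> 1"
        by (simp add: riemannian_norm_def gM norm_eq_sqrt_inner)
      then have "norm a * norm (M v) \<le> norm a * 1"
        by (intro mult_left_mono) auto
      then show "\<beta> x v \<le> norm a"
        using norm_cauchy_schwarz[of a "M v"] by (simp add: \<beta>M)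
    qed
    have "norm a = \<beta> x v"
      using False by (simp add: \<beta>M Mv sgn_div_norm dot_square_norm power2_eq_square)
    also have "\<dots> \<le> dual (riemannian_norm g) x (\<beta> x)"
      unfolding dual_def
      by (rule cSUP_upper[OF _ bdd]) (simp add: riemannian_norm_def gM Mv norm_eq_sqrt_inner[symmetric] norm_sgn)
    also have "\<dots> < 1"
      using R by (simp add: randers_data_def)
    finally show ?thesis .
  qed simp
  then show ?thesis
    using M gM \<beta>M by (intro exI[of _ M] exI[of _ a]) simp
qed

text \<open>Half the differential of \<open>F\<^sup>2\<close> is the Legendre map, pulled back by \<open>N\<close>; the fundamental tensor is the
derivative of this map. The transpose appears because the first index of \<open>fundamental_tensor\<close> is
that of the outer differentiation.\<close>

lemma fundamental_tensor_frame:
  assumes N: "linear N" "bij N"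
    and F: "\<And>z. F x (tangent_of A c x z) = randers_norm a (N z)"
    and u: "u \<noteq> 0"
  shows "fundamental_tensor A F c x u =
    transpose (matrix (\<lambda>h. adjoint N (legendre_deriv a (N u) (N h))))"
proof -
  define T where "T = adjoint N"
  have N0: "N w = 0 \<longleftrightarrow> w = 0" for w
    using linear_injective_0[OF N(1)] bij_is_inj[OF N(2)] linear_0[OF N(1)] by auto
  have linT: "linear T"
    unfolding T_def using N(1) by (rule adjoint_linear)
  have square: "frechet_derivative (\<lambda>z. (F x (tangent_of A c x z))\<^sup>2) (at w) h =
      2 * (T (legendre_map a (N w)) \<bullet> h)" if "w \<noteq> 0" for w h
  proof -
    have "(((\<lambda>y. (randers_norm a y)\<^sup>2) \<circ> N) has_derivative
        ((\<lambda>h. 2 * (legendre_map a (N w) \<bullet> h)) \<circ> N)) (at w)"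
      using that by (intro diff_chain_at linear_imp_has_derivative N has_derivative_randers_norm_square)
        (simp add: N0)
    then have "frechet_derivative (\<lambda>z. (F x (tangent_of A c x z))\<^sup>2) (at w) =
        (\<lambda>h. 2 * (legendre_map a (N w) \<bullet> N h))"
      by (intro frechet_derivative_at[symmetric]) (simp add: F o_def)
    then show ?thesis
      using adjoint_works[OF N(1), of h "legendre_map a (N w)"] by (simp add: T_def inner_commute)
  qed
  have entry: "frechet_derivative
      (\<lambda>w. frechet_derivative (\<lambda>z. (F x (tangent_of A c x z))\<^sup>2) (at w) (axis j 1)) (at u) (axis i 1) =
      2 * (T (legendre_deriv a (N u) (N (axis i 1))) \<bullet> axis j 1)" for i j
  proof -
    have "((legendre_map a \<circ> N) has_derivative (legendre_deriv a (N u) \<circ> N)) (at u)"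
      using u by (intro diff_chain_at has_derivative_legendre_map linear_imp_has_derivative N) (simp add: N0)
    then have "((T \<circ> (legendre_map a \<circ> N)) has_derivative (T \<circ> (legendre_deriv a (N u) \<circ> N))) (at u)"
      by (rule diff_chain_at) (rule linear_imp_has_derivative[OF linT])
    then have "((\<lambda>w. 2 * ((T \<circ> (legendre_map a \<circ> N)) w \<bullet> axis j 1)) has_derivative
        (\<lambda>h. 2 * ((T \<circ> (legendre_deriv a (N u) \<circ> N)) h \<bullet> axis j 1))) (at u)"
      by (intro has_derivative_mult_right has_derivative_inner_left)
    then have "((\<lambda>w. frechet_derivative (\<lambda>z. (F x (tangent_of A c x z))\<^sup>2) (at w) (axis j 1)) has_derivative
        (\<lambda>h. 2 * ((T \<circ> (legendre_deriv a (N u) \<circ> N)) h \<bullet> axis j 1))) (at u)"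
      by (rule has_derivative_transform_within_open[of _ _ _ _ "- {0}"]) (use u in \<open>auto simp: square\<close>)
    from frechet_derivative_at[OF this, symmetric] show ?thesis
      by simp
  qed
  show ?thesis
    by (simp add: fundamental_tensor_def entry vec_eq_iff transpose_def matrix_def inner_axis T_def)
qed

lemma holmes_thompson_density_randers:
  fixes g :: "'a::topological_space \<Rightarrow> real ^ 'n \<Rightarrow> real ^ 'n \<Rightarrow> real"
  assumes A: "smooth_atlas A" and R: "randers_data A g \<beta>" and c: "c \<in> A" and x: "x \<in> fst c"
  shows "holmes_thompson_density A (randers g \<beta>) c x = riemannian_density A g c x"
proof -
  obtain M :: "real ^ 'n \<Rightarrow> real ^ 'n" and a where M: "linear M" "bij M" and a: "norm a < 1"
    and "\<forall>v w. g x v w = M v \<bullet> M w" "\<forall>v. \<beta> x v = a \<bullet> M v"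
    using randers_frame[OF R, of x] by blast
  then have gM: "\<And>v w. g x v w = M v \<bullet> M w" and \<beta>M: "\<And>v. \<beta> x v = a \<bullet> M v"
    by simp_all
  define N where "N = M \<circ> tangent_of A c x"
  have N: "linear N" "bij N"
    unfolding N_def using tangent_of_isomorphism[OF A c x] M by (auto intro: linear_compose bij_comp)
  have F: "randers g \<beta> x (tangent_of A c x z) = randers_norm a (N z)" for z
    by (simp add: randers_def gM \<beta>M N_def randers_norm_def norm_eq_sqrt_inner)
  have "(LINT u : {u. randers_norm a (N u) < 1} | lborel. det (fundamental_tensor A (randers g \<beta>) c x u)) =
      \<bar>det (matrix N)\<bar> * measure lborel (ball (0 :: real ^ 'n) 1)"
    using a N by (rule integral_det_legendre)
      (simp add: fundamental_tensor_frame[where F = "randers g \<beta>" and x = x and c = c and A = A, OF N F])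
  moreover have "measure lborel (ball (0 :: real ^ 'n) 1) > 0"
    using content_ball_pos[of 1 "0 :: real ^ 'n"] by simp
  ultimately have "holmes_thompson_density A (randers g \<beta>) c x = \<bar>det (matrix N)\<bar>"
    by (simp add: holmes_thompson_density_def F)
  also have "\<dots> = sqrt (det (transpose (matrix N) ** matrix N))"
    by (simp add: det_mul real_sqrt_mult_self)
  also have "transpose (matrix N) ** matrix N =
      (\<chi> i j. g x (tangent_of A c x (axis i 1)) (tangent_of A c x (axis j 1)))"
    by (simp add: vec_eq_iff matrix_matrix_mult_def transpose_def matrix_def gM N_def inner_vec_def)
  finally show ?thesis
    by (simp add: riemannian_density_def)
qed

text \<open>The measure is a definite description, so equal densities give equal measures whether or not a
measure with these densities exists.\<close>

lemma density_measure_cong: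
  assumes "\<And>c x. c \<in> A \<Longrightarrow> x \<in> fst c \<Longrightarrow> \<sigma> c x = \<tau> c x"
  shows "density_measure A \<sigma> = density_measure A \<tau>"
proof -
  have eq: "(\<integral>\<^sup>+ y. ennreal (\<sigma> c (coord_inv c y)) * indicator (snd c ` B) y \<partial>lborel) =
      (\<integral>\<^sup>+ y. ennreal (\<tau> c (coord_inv c y)) * indicator (snd c ` B) y \<partial>lborel)"
    if "c \<in> A" "B \<subseteq> fst c" for c B
  proof (rule nn_integral_cong)
    fix y
    have "coord_inv c y \<in> fst c" if "y \<in> snd c ` B"
      unfolding coord_inv_def using that \<open>B \<subseteq> fst c\<close> by (intro inv_into_into) auto
    then show "ennreal (\<sigma> c (coord_inv c y)) * indicator (snd c ` B) y =
        ennreal (\<tau> c (coord_inv c y)) * indicator (snd c ` B) y"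
      using assms[OF \<open>c \<in> A\<close>] by (simp add: indicator_def)
  qed
  have "(\<forall>c\<in>A. \<forall>B\<in>sets borel. B \<subseteq> fst c \<longrightarrow> emeasure m B =
          (\<integral>\<^sup>+ y. ennreal (\<sigma> c (coord_inv c y)) * indicator (snd c ` B) y \<partial>lborel)) \<longleftrightarrow>
      (\<forall>c\<in>A. \<forall>B\<in>sets borel. B \<subseteq> fst c \<longrightarrow> emeasure m B =
          (\<integral>\<^sup>+ y. ennreal (\<tau> c (coord_inv c y)) * indicator (snd c ` B) y \<partial>lborel))" for m
    by (intro ball_cong refl imp_cong) (simp add: eq)
  then show ?thesis
    unfolding density_measure_def by simp
qed

lemma holmes_thompson_measure_randers:
  assumes "smooth_atlas A" "randers_data A g \<beta>"
  shows "holmes_thompson_measure A (randers g \<beta>) = riemannian_measure A g"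
  unfolding holmes_thompson_measure_def riemannian_measure_def
  by (rule density_measure_cong) (rule holmes_thompson_density_randers[OF assms])

section \<open>Dual norms and the Legendre transform\<close>

text \<open>The supremum of an unbounded set of reals is an unspecified value, so every estimate of \<open>dual\<close>
rests on this bound. It holds because \<open>\<omega>\<close> is bounded on the unit ball of an orthonormal frame.\<close>

lemma bdd_above_riemannian_unit_ball:
  fixes g :: "'a \<Rightarrow> real ^ 'n \<Rightarrow> real ^ 'n \<Rightarrow> real" and \<omega> :: "real ^ 'n \<Rightarrow> real"
  assumes R: "randers_data A g \<beta>" and \<omega>: "linear \<omega>"
  shows "bdd_above (\<omega> ` {v. riemannian_norm g x v \<le> 1})"
proof -
  obtain M :: "real ^ 'n \<Rightarrow> real ^ 'n" where M: "linear M" "bij M"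
    and gM: "\<forall>v w. g x v w = M v \<bullet> M w"
    using randers_frame[OF R, of x] by blast
  have "linear (\<omega> \<circ> inv M)"
    using M \<omega> by (intro linear_compose inj_linear_imp_inv_linear bij_is_inj)
  then obtain K where K: "\<And>y. norm ((\<omega> \<circ> inv M) y) \<le> K * norm y" "K > 0"
    using linear_bounded_pos by blast
  show ?thesis
  proof (rule bdd_aboveI2)
    fix v assume "v \<in> {v. riemannian_norm g x v \<le> 1}"
    then have "norm (M v) \<le> 1"
      by (simp add: riemannian_norm_def gM norm_eq_sqrt_inner)
    then have "K * norm (M v) \<le> K * 1"
      using K(2) by (intro mult_left_mono) auto
    moreover have "norm (\<omega> v) \<le> K * norm (M v)"
      using K(1)[of "M v"] M by (simp add: bij_is_inj)
    ultimately show "\<omega> v \<le> K"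
      by simp
  qed
qed

text \<open>The identity \<open>F (\<nabla>f) = F\<^sup>* (df)\<close> for Randers metrics, transported from the normal form.\<close>

lemma legendre_dual_randers:
  fixes g :: "'a \<Rightarrow> real ^ 'n \<Rightarrow> real ^ 'n \<Rightarrow> real" and \<omega> :: "real ^ 'n \<Rightarrow> real"
  assumes R: "randers_data A g \<beta>" and \<omega>: "linear \<omega>"
  shows "randers g \<beta> x (legendre (randers g \<beta>) x \<omega>) = dual (randers g \<beta>) x \<omega>"
proof -
  obtain M :: "real ^ 'n \<Rightarrow> real ^ 'n" and a where M: "linear M" "bij M" and a: "norm a < 1"
    and gM: "\<forall>v w. g x v w = M v \<bullet> M w" and \<beta>M: "\<forall>v. \<beta> x v = a \<bullet> M v"
    using randers_frame[OF R, of x] by blast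
  have F: "randers g \<beta> x v = randers_norm a (M v)" for v
    by (simp add: randers_def gM \<beta>M randers_norm_def norm_eq_sqrt_inner)
  define c where "c = adjoint (\<omega> \<circ> inv M) 1"
  have lin: "linear (\<omega> \<circ> inv M)"
    using M \<omega> by (intro linear_compose inj_linear_imp_inv_linear bij_is_inj)
  have \<omega>M: "\<omega> v = c \<bullet> M v" for v
    using adjoint_works[OF lin, of "M v" 1] M by (simp add: c_def inner_commute bij_is_inj)
  obtain y where
    max: "\<And>z. c \<bullet> z - (randers_norm a z)\<^sup>2 / 2 \<le> c \<bullet> y - (randers_norm a y)\<^sup>2 / 2"
    and unique: "\<And>z. c \<bullet> z - (randers_norm a z)\<^sup>2 / 2 = c \<bullet> y - (randers_norm a y)\<^sup>2 / 2 \<Longrightarrow> z = y"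
    and le: "\<And>z. c \<bullet> z \<le> randers_norm a y * randers_norm a z"
    and eq: "c \<bullet> y = (randers_norm a y)\<^sup>2"
    using randers_maximizer[OF a, of c] by blast
  define v where "v = inv M y"
  have Mv: "M v = y"
    using M by (simp add: v_def bij_is_surj surj_f_inv_f)
  have "legendre (randers g \<beta>) x \<omega> = v"
    unfolding legendre_def
  proof (rule the_equality)
    show "is_arg_max (\<lambda>v. \<omega> v - (randers g \<beta> x v)\<^sup>2 / 2) (\<lambda>_. True) v"
      using max by (auto simp: is_arg_max_def F \<omega>M Mv not_less)
    fix w assume "is_arg_max (\<lambda>v. \<omega> v - (randers g \<beta> x v)\<^sup>2 / 2) (\<lambda>_. True) w"
    then have "c \<bullet> M w - (randers_norm a (M w))\<^sup>2 / 2 \<ge> c \<bullet> M v - (randers_norm a (M v))\<^sup>2 / 2"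
      by (auto simp: is_arg_max_def F \<omega>M not_less)
    then have "c \<bullet> M w - (randers_norm a (M w))\<^sup>2 / 2 = c \<bullet> y - (randers_norm a y)\<^sup>2 / 2"
      using max[of "M w"] unfolding Mv by (rule antisym[rotated])
    then have "M w = y"
      by (rule unique)
    then show "w = v"
      using M by (simp add: v_def bij_is_inj flip: \<open>M w = y\<close>)
  qed
  moreover have "dual (randers g \<beta>) x \<omega> = randers_norm a y"
    unfolding dual_def
  proof (rule cSup_eq_maximum)
    have y_le: "\<omega> w \<le> randers_norm a y" if "randers g \<beta> x w \<le> 1" for w
    proof -
      have "randers_norm a y * randers_norm a (M w) \<le> randers_norm a y * 1"
        using that randers_norm_nonneg[OF a] by (intro mult_left_mono) (auto simp: F)
      then show ?thesis
        using le[of "M w"] by (simp add: \<omega>M)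
    qed
    then show "r \<le> randers_norm a y" if "r \<in> \<omega> ` {v. randers g \<beta> x v \<le> 1}" for r
      using that by auto
    show "randers_norm a y \<in> \<omega> ` {v. randers g \<beta> x v \<le> 1}"
    proof (cases "y = 0")
      case True
      have "\<omega> 0 = 0" "randers g \<beta> x 0 \<le> 1"
        using linear_0[OF \<omega>] linear_0[OF M(1)] by (simp_all add: F)
      then show ?thesis
        using True by (intro image_eqI[of _ _ 0]) simp_all
    next
      case False
      then have pos: "randers_norm a y > 0"
        by (rule randers_norm_pos[OF a])
      define w where "w = inverse (randers_norm a y) *\<^sub>R v"
      have Mw: "M w = inverse (randers_norm a y) *\<^sub>R y"
        by (simp add: w_def linear_scale[OF M(1)] Mv)
      have "randers g \<beta> x w = 1"
        using pos unfolding F Mw by (subst randers_norm_scaleR) simp_all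
      moreover have "\<omega> w = randers_norm a y"
        using pos by (simp add: \<omega>M Mw eq power2_eq_square)
      ultimately show ?thesis
        by (intro image_eqI[of _ _ w]) simp_all
    qed
  qed
  ultimately show ?thesis
    by (simp add: F Mv)
qed

lemma dual_nonneg:
  assumes "linear \<omega>" "bdd_above (\<omega> ` {v. F x v \<le> 1})" "F x 0 \<le> 1"
  shows "dual F x \<omega> \<ge> 0"
proof -
  have "\<omega> 0 \<le> dual F x \<omega>"
    unfolding dual_def using assms by (intro cSUP_upper) auto
  then show ?thesis
    using linear_0[OF assms(1)] by simp
qed

text \<open>If \<open>v\<close> lies in the unit ball of \<open>F\<close>, then \<open>v / K\<close> lies in that of \<open>G\<close>. Boundedness for \<open>G\<close> passes to \<open>F\<close>
by the same estimate.\<close>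

lemma dual_le_scale:
  assumes \<omega>: "linear \<omega>" and bdd: "bdd_above (\<omega> ` {v. G x v \<le> 1})"
    and K: "K > 0" and le: "\<And>v. G x v \<le> K * F x v"
    and hom: "\<And>c v. c \<ge> 0 \<Longrightarrow> G x (c *\<^sub>R v) = c * G x v" and F0: "F x 0 \<le> 1"
  shows "bdd_above (\<omega> ` {v. F x v \<le> 1})" "dual F x \<omega> \<le> K * dual G x \<omega>"
proof -
  have *: "\<omega> v \<le> K * dual G x \<omega>" if "F x v \<le> 1" for v
  proof -
    have "G x (inverse K *\<^sub>R v) = inverse K * G x v"
      using K by (intro hom) simp
    also have "\<dots> \<le> inverse K * (K * 1)"
      using that K le[of v] by (intro mult_left_mono) (auto intro: order_trans)
    finally have "G x (inverse K *\<^sub>R v) \<le> 1"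
      using K by simp
    then have "\<omega> (inverse K *\<^sub>R v) \<le> dual G x \<omega>"
      unfolding dual_def by (intro cSUP_upper[OF _ bdd]) simp
    then show ?thesis
      using K by (simp add: linear_scale[OF \<omega>] field_simps)
  qed
  show "bdd_above (\<omega> ` {v. F x v \<le> 1})"
    by (rule bdd_aboveI2[where M = "K * dual G x \<omega>"]) (simp add: *)
  show "dual F x \<omega> \<le> K * dual G x \<omega>"
    unfolding dual_def[of F] using F0 * by (intro cSUP_least) auto
qed

section \<open>Comparison of energies and Sobolev spaces\<close>

text \<open>For arbitrary \<open>f\<close> this holds because \<open>c\<close> times a simple minorant of \<open>f\<close> is a simple minorant of
\<open>c * f\<close>. It serves for integrands like \<open>x \<mapsto> dual F x (\<omega> x)\<close>, whose measurability would take an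
argument of its own.\<close>

lemma nn_integral_cmult_le:
  fixes c :: ennreal
  shows "c * (\<integral>\<^sup>+ x. f x \<partial>M) \<le> (\<integral>\<^sup>+ x. c * f x \<partial>M)"
proof -
  have "c * integral\<^sup>S M s \<le> (\<integral>\<^sup>+ x. c * f x \<partial>M)" if s: "simple_function M s" "s \<le> f" for s
  proof -
    have "c * integral\<^sup>S M s = integral\<^sup>S M (\<lambda>x. c * s x)"
      using s by (simp add: simple_integral_mult)
    also have "\<dots> = (\<integral>\<^sup>+ x. c * s x \<partial>M)"
      using s by (intro nn_integral_eq_simple_integral[symmetric] simple_function_mult) auto
    also have "\<dots> \<le> (\<integral>\<^sup>+ x. c * f x \<partial>M)"
      using s by (intro nn_integral_mono mult_left_mono) (auto simp: le_fun_def)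
    finally show ?thesis .
  qed
  then show ?thesis
    unfolding nn_integral_def[of M f] SUP_mult_left_ennreal by (intro SUP_least) auto
qed

lemma nn_integral_powr_le:
  assumes K: "K > 0" and p: "p \<ge> 0"
    and le: "\<And>x. f x \<le> K * h x" and nonneg: "\<And>x. f x \<ge> 0" "\<And>x. h x \<ge> 0"
  shows "(\<integral>\<^sup>+ x. ennreal (f x powr p) \<partial>m) \<le> ennreal (K powr p) * (\<integral>\<^sup>+ x. ennreal (h x powr p) \<partial>m)"
proof -
  have inv: "ennreal (K powr p) * ennreal (inverse (K powr p)) = 1"
    using K by (simp add: ennreal_mult[symmetric])
  have "ennreal (inverse (K powr p)) * (\<integral>\<^sup>+ x. ennreal (f x powr p) \<partial>m) \<le>
      (\<integral>\<^sup>+ x. ennreal (inverse (K powr p)) * ennreal (f x powr p) \<partial>m)"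
    by (rule nn_integral_cmult_le)
  also have "\<dots> \<le> (\<integral>\<^sup>+ x. ennreal (h x powr p) \<partial>m)"
  proof (rule nn_integral_mono)
    fix x
    have "f x powr p \<le> (K * h x) powr p"
      using p nonneg le by (intro powr_mono2) auto
    also have "\<dots> = K powr p * h x powr p"
      using K nonneg by (simp add: powr_mult)
    finally have "inverse (K powr p) * f x powr p \<le> h x powr p"
      using K by (simp add: field_simps)
    then show "ennreal (inverse (K powr p)) * ennreal (f x powr p) \<le> ennreal (h x powr p)"
      by (simp add: ennreal_mult[symmetric] ennreal_leI)
  qed
  finally have "ennreal (K powr p) * (ennreal (inverse (K powr p)) * (\<integral>\<^sup>+ x. ennreal (f x powr p) \<partial>m)) \<le>
      ennreal (K powr p) * (\<integral>\<^sup>+ x. ennreal (h x powr p) \<partial>m)"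
    by (rule mult_left_mono) simp
  then show ?thesis
    by (simp add: mult.assoc[symmetric] inv)
qed

text \<open>The factor is first moved to the left, where monotonicity of the product is enough.\<close>

lemma INF_le_cmult_INF:
  fixes a b :: "'i \<Rightarrow> ennreal"
  assumes k: "k > 0" and le: "\<And>i. i \<in> I \<Longrightarrow> a i \<le> ennreal k * b i"
  shows "(INF i\<in>I. a i) \<le> ennreal k * (INF i\<in>I. b i)"
proof -
  have inv: "ennreal (inverse k) * ennreal k = 1" "ennreal k * ennreal (inverse k) = 1"
    using k by (simp_all add: ennreal_mult[symmetric])
  have "ennreal (inverse k) * (INF i\<in>I. a i) \<le> b i" if "i \<in> I" for i
  proof -
    have "ennreal (inverse k) * (INF i\<in>I. a i) \<le> ennreal (inverse k) * (ennreal k * b i)"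
      using that by (intro mult_left_mono order_trans[OF INF_lower[OF that] le]) auto
    then show ?thesis
      by (simp add: mult.assoc[symmetric] inv)
  qed
  then have "ennreal (inverse k) * (INF i\<in>I. a i) \<le> (INF i\<in>I. b i)"
    by (intro INF_greatest)
  then have "ennreal k * (ennreal (inverse k) * (INF i\<in>I. a i)) \<le> ennreal k * (INF i\<in>I. b i)"
    by (rule mult_left_mono) simp
  then show ?thesis
    by (simp add: mult.assoc[symmetric] inv)
qed

text \<open>Non-negativity is included because the comparison is always used under a real power.\<close>

definition dual_comparable ::
  "real \<Rightarrow> ('a, 'n::finite) finsler \<Rightarrow> ('a, 'n) finsler \<Rightarrow> bool" where
  "dual_comparable K F G \<longleftrightarrow> (\<forall>x \<omega>. linear \<omega> \<longrightarrow> 0 \<le> dual F x \<omega> \<and> dual F x \<omega> \<le> K * dual G x \<omega>)"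

text \<open>\<open>K \<ge> 1\<close> is what lets the same factor serve for the zeroth-order part, which does not depend on the
metric.\<close>

lemma sobolev_energy_le:
  assumes K: "K \<ge> 1" and p: "p \<ge> 0" and \<omega>: "\<And>x. linear (\<omega> x)"
    and FG: "dual_comparable K F G" and GF: "dual_comparable K G F"
  shows "sobolev_energy F m p f \<omega> \<le> ennreal (K powr p) * sobolev_energy G m p f \<omega>"
proof -
  have neg: "linear (\<lambda>v. - \<omega> x v)" for x
    using linear_compose_neg[OF \<omega>[of x]] by simp
  have "(\<integral>\<^sup>+ x. ennreal (max (dual F x (\<omega> x)) (dual F x (\<lambda>v. - \<omega> x v)) powr p) \<partial>m) \<le>
    ennreal (K powr p) * (\<integral>\<^sup>+ x. ennreal (max (dual G x (\<omega> x)) (dual G x (\<lambda>v. - \<omega> x v)) powr p) \<partial>m)"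
  proof (rule nn_integral_powr_le)
    fix x
    have F: "0 \<le> dual F x (\<omega> x)" "dual F x (\<omega> x) \<le> K * dual G x (\<omega> x)"
      "dual F x (\<lambda>v. - \<omega> x v) \<le> K * dual G x (\<lambda>v. - \<omega> x v)"
      and G: "0 \<le> dual G x (\<omega> x)"
      using FG GF \<omega> neg by (auto simp: dual_comparable_def)
    show "max (dual F x (\<omega> x)) (dual F x (\<lambda>v. - \<omega> x v)) \<ge> 0"
      "max (dual G x (\<omega> x)) (dual G x (\<lambda>v. - \<omega> x v)) \<ge> 0"
      using F G by auto
    have "K * dual G x (\<omega> x) \<le> K * max (dual G x (\<omega> x)) (dual G x (\<lambda>v. - \<omega> x v))"
      "K * dual G x (\<lambda>v. - \<omega> x v) \<le> K * max (dual G x (\<omega> x)) (dual G x (\<lambda>v. - \<omega> x v))"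
      using K by (auto intro!: mult_left_mono)
    then show "max (dual F x (\<omega> x)) (dual F x (\<lambda>v. - \<omega> x v)) \<le>
        K * max (dual G x (\<omega> x)) (dual G x (\<lambda>v. - \<omega> x v))"
      using F by linarith
  qed (use K p in auto)
  moreover have "1 * (\<integral>\<^sup>+ x. ennreal (\<bar>f x\<bar> powr p) \<partial>m) \<le> ennreal (K powr p) * (\<integral>\<^sup>+ x. ennreal (\<bar>f x\<bar> powr p) \<partial>m)"
    using K p by (intro mult_right_mono) (auto simp: ge_one_powr_ge_zero)
  ultimately show ?thesis
    unfolding sobolev_energy_def distrib_left by (intro add_mono) auto
qed

text \<open>Comparable metrics have the same approximating sequences of smooth functions.\<close>

lemma sobolev_subset:
  assumes A: "smooth_atlas A" and K: "K \<ge> 1" and p: "p \<ge> 0"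
    and FG: "dual_comparable K F G" and GF: "dual_comparable K G F"
  shows "sobolev A G m p \<subseteq> sobolev A F m p"
proof (clarsimp simp: sobolev_def)
  fix f \<omega> u
  assume \<omega>: "measurable_covector_field A \<omega>"
    and u: "\<forall>k. smooth_fun A (u k) \<and> sobolev_energy G m p (u k) (differential A (u k)) < top"
    and lim: "(\<lambda>k. sobolev_energy G m p (\<lambda>x. u k x - f x) (\<lambda>x v. differential A (u k) x v - \<omega> x v)) \<longlonglongrightarrow> 0"
  have lin: "linear (differential A (u k) x)" for k x
    using linear_differential[OF A] u by blast
  have lin_diff: "linear (\<lambda>v. differential A (u k) x v - \<omega> x v)" for k x
    using lin \<omega> by (intro linear_compose_sub) (auto simp: measurable_covector_field_def)
  have "sobolev_energy F m p (u k) (differential A (u k)) < top" for k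
  proof -
    have "sobolev_energy F m p (u k) (differential A (u k)) \<le>
        ennreal (K powr p) * sobolev_energy G m p (u k) (differential A (u k))"
      using K p lin FG GF by (intro sobolev_energy_le)
    also have "\<dots> < top"
      using u by (simp add: ennreal_mult_less_top)
    finally show ?thesis .
  qed
  moreover have "(\<lambda>k. sobolev_energy F m p (\<lambda>x. u k x - f x) (\<lambda>x v. differential A (u k) x v - \<omega> x v)) \<longlonglongrightarrow> 0"
  proof (rule tendsto_sandwich[OF _ _ tendsto_const])
    show "(\<lambda>k. ennreal (K powr p) *
        sobolev_energy G m p (\<lambda>x. u k x - f x) (\<lambda>x v. differential A (u k) x v - \<omega> x v)) \<longlonglongrightarrow> 0"
      using ennreal_tendsto_cmult[OF _ lim, of "ennreal (K powr p)"] by simp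
    show "\<forall>\<^sub>F k in sequentially.
        sobolev_energy F m p (\<lambda>x. u k x - f x) (\<lambda>x v. differential A (u k) x v - \<omega> x v) \<le>
        ennreal (K powr p) *
        sobolev_energy G m p (\<lambda>x. u k x - f x) (\<lambda>x v. differential A (u k) x v - \<omega> x v)"
      using K p lin_diff FG GF by (intro always_eventually allI sobolev_energy_le)
  qed auto
  ultimately show "\<exists>u. (\<forall>k. smooth_fun A (u k) \<and> sobolev_energy F m p (u k) (differential A (u k)) < top) \<and>
      (\<lambda>k. sobolev_energy F m p (\<lambda>x. u k x - f x) (\<lambda>x v. differential A (u k) x v - \<omega> x v)) \<longlonglongrightarrow> 0"
    using u by (intro exI[of _ u]) simp
qed

lemma sobolev_linear: "(f, \<omega>) \<in> sobolev A F m p \<Longrightarrow> linear (\<omega> x)"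
  by (auto simp: sobolev_def measurable_covector_field_def)

section \<open>Reversibility\<close>

lemma randers_pos:
  fixes g :: "'a \<Rightarrow> real ^ 'n \<Rightarrow> real ^ 'n \<Rightarrow> real"
  assumes R: "randers_data A g \<beta>" and v: "v \<noteq> 0"
  shows "randers g \<beta> x v > 0"
proof -
  obtain M :: "real ^ 'n \<Rightarrow> real ^ 'n" and a where M: "linear M" "bij M" and a: "norm a < 1"
    and gM: "\<forall>v w. g x v w = M v \<bullet> M w" and \<beta>M: "\<forall>v. \<beta> x v = a \<bullet> M v"
    using randers_frame[OF R, of x] by blast
  have "M v \<noteq> 0"
    using linear_injective_0[OF M(1)] bij_is_inj[OF M(2)] v by auto
  then show ?thesis
    using randers_norm_pos[OF a, of "M v"]
    by (simp add: randers_def gM \<beta>M randers_norm_def norm_eq_sqrt_inner)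
qed

lemma reversibility_le:
  assumes pos: "\<And>x v. v \<noteq> 0 \<Longrightarrow> F x v > 0" and fin: "reversibility F < \<infinity>" and v: "v \<noteq> 0"
  shows "F x v \<le> enn2real (reversibility F) * F x (- v)"
proof -
  have "ennreal (F x v / F x (- v)) \<le> reversibility F"
    unfolding reversibility_def using v by (intro SUP_upper2[of x] SUP_upper) auto
  then have "enn2real (ennreal (F x v / F x (- v))) \<le> enn2real (reversibility F)"
    using fin by (intro enn2real_mono) auto
  moreover have "F x v / F x (- v) \<ge> 0"
    using pos[of v x] pos[of "- v" x] v by simp
  ultimately show ?thesis
    using pos[of "- v" x] v by (simp add: field_simps)
qed

text \<open>The ratios at \<open>v\<close> and at \<open>- v\<close> are inverse to each other.\<close>

lemma reversibility_ge_1: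
  fixes F :: "('a, 'n::finite) finsler"
  assumes pos: "\<And>x v. v \<noteq> 0 \<Longrightarrow> F x v > 0" and fin: "reversibility F < \<infinity>"
  shows "enn2real (reversibility F) \<ge> 1"
proof (rule ccontr)
  define k where "k = enn2real (reversibility F)"
  assume "\<not> enn2real (reversibility F) \<ge> 1"
  then have k: "k < 1" by (simp add: k_def)
  obtain x :: 'a where True by simp
  define v :: "real ^ 'n" where "v = axis undefined 1"
  have v: "v \<noteq> 0" "- v \<noteq> 0"
    by (simp_all add: v_def axis_eq_0_iff)
  have "F x v \<le> k * F x (- v)" "F x (- v) \<le> k * F x v"
    using reversibility_le[of F v x, OF pos fin] reversibility_le[of F "- v" x, OF pos fin] v by (auto simp: k_def)
  moreover have "k * F x v < F x v" "k * F x (- v) < F x (- v)"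
    using k pos[OF v(1), of x] pos[OF v(2), of x] by simp_all
  ultimately show False
    by linarith
qed


text \<open>Reversing \<open>v\<close> cancels the one-form: \<open>F v + F (- v) = 2 * \<bar>v\<bar>\<close>. Together with \<open>F v \<le> K * F (- v)\<close> and its
reversal this gives \<open>(1 + K) * F v \<le> 2 * K * \<bar>v\<bar>\<close> and \<open>2 * \<bar>v\<bar> \<le> (1 + K) * F v\<close>, and \<open>K \<ge> 1\<close> does the rest.\<close>

lemma randers_comparable:
  fixes g :: "'a \<Rightarrow> real ^ 'n \<Rightarrow> real ^ 'n \<Rightarrow> real"
  assumes R: "randers_data A g \<beta>" and fin: "reversibility (randers g \<beta>) < \<infinity>"
  defines "K \<equiv> enn2real (reversibility (randers g \<beta>))"
  shows "randers g \<beta> x v \<le> K * riemannian_norm g x v"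
    "riemannian_norm g x v \<le> K * randers g \<beta> x v"
proof -
  let ?F = "randers g \<beta> x" and ?N = "riemannian_norm g x"
  have lin: "bilinear (g x)" "linear (\<beta> x)" and nonneg: "g x v v \<ge> 0"
    using R by (auto simp: randers_data_def riemannian_metric_def one_form_def)
      (metis bilinear_lzero less_eq_real_def)
  have "?F v \<le> K * ?F (- v) \<and> ?F (- v) \<le> K * ?F v"
  proof (cases "v = 0")
    case True
    then show ?thesis
      using lin by (simp add: randers_def bilinear_lzero linear_0)
  next
    case False
    then show ?thesis
      using reversibility_le[OF randers_pos[OF R] fin, of v x]
        reversibility_le[OF randers_pos[OF R] fin, of "- v" x] by (simp add: K_def)
  qed
  moreover have "?F v + ?F (- v) = 2 * ?N v"
    using lin by (simp add: randers_def riemannian_norm_def bilinear_lneg bilinear_rneg linear_neg)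
  then have "?F (- v) = 2 * ?N v - ?F v"
    by simp
  ultimately have F: "?F v \<le> K * (2 * ?N v - ?F v)" "2 * ?N v - ?F v \<le> K * ?F v"
    by simp_all
  have K: "K \<ge> 1"
    unfolding K_def using randers_pos[OF R] fin by (rule reversibility_ge_1)
  have N: "?N v \<ge> 0"
    using nonneg by (simp add: riemannian_norm_def)
  have "(1 + K) * ?F v \<le> 2 * (K * ?N v)"
    using F(1) by (simp add: algebra_simps)
  also have "\<dots> \<le> (1 + K) * (K * ?N v)"
    using K N by (intro mult_right_mono) auto
  finally show "?F v \<le> K * ?N v"
    using K by (simp add: mult_le_cancel_left)
  have "?F v \<ge> 0"
    using randers_pos[OF R, of v x] lin by (cases "v = 0") (auto simp: randers_def bilinear_lzero linear_0)
  then have "1 * ?F v \<le> K * ?F v"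
    using K by (rule mult_right_mono[rotated])
  then show "?N v \<le> K * ?F v"
    using F(2) by simp
qed

lemma dual_comparable_randers:
  fixes g :: "'a \<Rightarrow> real ^ 'n \<Rightarrow> real ^ 'n \<Rightarrow> real"
  assumes R: "randers_data A g \<beta>" and fin: "reversibility (randers g \<beta>) < \<infinity>"
  defines "K \<equiv> enn2real (reversibility (randers g \<beta>))"
  shows "dual_comparable K (randers g \<beta>) (riemannian_norm g)"
    "dual_comparable K (riemannian_norm g) (randers g \<beta>)"
proof -
  let ?F = "randers g \<beta>" and ?N = "riemannian_norm g"
  have K: "K \<ge> 1"
    unfolding K_def using randers_pos[OF R] fin by (rule reversibility_ge_1)
  note comparable = randers_comparable[OF R fin, folded K_def]
  have "0 \<le> dual ?F x \<omega> \<and> dual ?F x \<omega> \<le> K * dual ?N x \<omega> \<and>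
      0 \<le> dual ?N x \<omega> \<and> dual ?N x \<omega> \<le> K * dual ?F x \<omega>" if \<omega>: "linear \<omega>" for x \<omega>
  proof -
    have lin: "bilinear (g x)" "linear (\<beta> x)"
      using R by (auto simp: randers_data_def riemannian_metric_def one_form_def)
    have zero: "?F x 0 \<le> 1" "?N x 0 \<le> 1"
      using lin by (simp_all add: randers_def riemannian_norm_def bilinear_lzero linear_0)
    have hom_N: "?N x (c *\<^sub>R v) = c * ?N x v" if "c \<ge> 0" for c v
      using that lin by (simp add: riemannian_norm_def bilinear_lmul bilinear_rmul real_sqrt_mult
          mult.assoc[symmetric])
    then have hom_F: "?F x (c *\<^sub>R v) = c * ?F x v" if "c \<ge> 0" for c v
      using that linear_scale[OF lin(2)]
      by (simp add: randers_def riemannian_norm_def[symmetric] distrib_left)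
    have bdd_N: "bdd_above (\<omega> ` {v. ?N x v \<le> 1})"
      using bdd_above_riemannian_unit_ball[OF R \<omega>] .
    have K0: "K > 0"
      using K by simp
    note F_le = dual_le_scale[where G = ?N and F = ?F and x = x, OF \<omega> bdd_N K0 comparable(2) hom_N zero(1)]
    note N_le = dual_le_scale[where G = ?F and F = ?N and x = x, OF \<omega> F_le(1) K0 comparable(1) hom_F zero(2)]
    show ?thesis
      using F_le(2) N_le(2) dual_nonneg[where F = ?F and x = x, OF \<omega> F_le(1) zero(1)]
        dual_nonneg[where F = ?N and x = x, OF \<omega> bdd_N zero(2)] by simp
  qed
  then show "dual_comparable K ?F ?N" "dual_comparable K ?N ?F"
    by (simp_all add: dual_comparable_def)
qed

section \<open>Comparison of the first eigenvalues\<close>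

lemma eigenvalue_finsler_cong_integrand:
  assumes "\<And>f \<omega> x. (f, \<omega>) \<in> sobolev A F m p \<Longrightarrow> F x (legendre F x (\<omega> x)) = dual F x (\<omega> x)"
  shows "eigenvalue_finsler A F m p = (INF (f, \<omega>) \<in> admissible A F m p.
     (\<integral>\<^sup>+ x. ennreal (dual F x (\<omega> x) powr p) \<partial>m) / (\<integral>\<^sup>+ x. ennreal (\<bar>f x\<bar> powr p) \<partial>m))"
  unfolding eigenvalue_finsler_def
  by (intro INF_cong refl) (auto simp: admissible_def assms)

text \<open>The admissible pairs and the denominators are common to both sides, so the infima are compared
term by term.\<close>

lemma rayleigh_INF_le:
  assumes K: "K \<ge> 1" and p: "p \<ge> 0"
    and FG: "dual_comparable K F G" and GF: "dual_comparable K G F"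
    and S: "S \<subseteq> sobolev A F m p"
  shows "(INF (f, \<omega>) \<in> S. (\<integral>\<^sup>+ x. ennreal (dual F x (\<omega> x) powr p) \<partial>m) / (\<integral>\<^sup>+ x. ennreal (\<bar>f x\<bar> powr p) \<partial>m)) \<le>
    ennreal (K powr p) *
    (INF (f, \<omega>) \<in> S. (\<integral>\<^sup>+ x. ennreal (dual G x (\<omega> x) powr p) \<partial>m) / (\<integral>\<^sup>+ x. ennreal (\<bar>f x\<bar> powr p) \<partial>m))"
proof (rule INF_le_cmult_INF)
  fix i assume "i \<in> S"
  obtain f \<omega> where i: "i = (f, \<omega>)"
    by (cases i)
  have lin: "linear (\<omega> x)" for x
    using \<open>i \<in> S\<close> S i sobolev_linear by blast
  have "(\<integral>\<^sup>+ x. ennreal (dual F x (\<omega> x) powr p) \<partial>m) \<le>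
      ennreal (K powr p) * (\<integral>\<^sup>+ x. ennreal (dual G x (\<omega> x) powr p) \<partial>m)"
    using K p FG GF lin by (intro nn_integral_powr_le) (auto simp: dual_comparable_def)
  then have "(\<integral>\<^sup>+ x. ennreal (dual F x (\<omega> x) powr p) \<partial>m) / (\<integral>\<^sup>+ x. ennreal (\<bar>f x\<bar> powr p) \<partial>m) \<le>
      ennreal (K powr p) * (\<integral>\<^sup>+ x. ennreal (dual G x (\<omega> x) powr p) \<partial>m) /
        (\<integral>\<^sup>+ x. ennreal (\<bar>f x\<bar> powr p) \<partial>m)"
    by (rule divide_right_mono_ennreal)
  then show "(case i of (f, \<omega>) \<Rightarrow>
        (\<integral>\<^sup>+ x. ennreal (dual F x (\<omega> x) powr p) \<partial>m) / (\<integral>\<^sup>+ x. ennreal (\<bar>f x\<bar> powr p) \<partial>m)) \<le>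
      ennreal (K powr p) * (case i of (f, \<omega>) \<Rightarrow>
        (\<integral>\<^sup>+ x. ennreal (dual G x (\<omega> x) powr p) \<partial>m) / (\<integral>\<^sup>+ x. ennreal (\<bar>f x\<bar> powr p) \<partial>m))"
    by (simp add: i ennreal_times_divide)
qed (use K in simp)

theorem theorem1p2:
  fixes A :: "('a::{t2_space, second_countable_topology}, 'n::finite) chart set"
    and g :: "'a \<Rightarrow> real ^ 'n \<Rightarrow> real ^ 'n \<Rightarrow> real"
    and \<beta> :: "'a \<Rightarrow> real ^ 'n \<Rightarrow> real"
    and F :: "('a, 'n) finsler"
    and p :: real
  assumes "smooth_atlas A"
    and "connected (UNIV :: 'a set)"
    and "randers_data A g \<beta>"
    and "F = randers g \<beta>"
    and "p > 1"
  shows "1 / epowr (reversibility F) p * eigenvalue_riemannian A g p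
           \<le> eigenvalue_finsler A F (holmes_thompson_measure A F) p
       \<and> eigenvalue_finsler A F (holmes_thompson_measure A F) p
           \<le> (if reversibility F = \<infinity> then \<infinity>
              else epowr (reversibility F) p * eigenvalue_riemannian A g p)"
proof (cases "reversibility F = \<infinity>")
  case True
  then show ?thesis
    by (simp add: epowr_def)
next
  case False
  note A = assms(1) and R = assms(3) and F = assms(4)
  have p: "p \<ge> 0"
    using assms(5) by simp
  have fin: "reversibility F < \<infinity>"
    using False by (simp add: less_top)
  define m where "m = riemannian_measure A g"
  define N where "N = riemannian_norm g"
  define K where "K = enn2real (reversibility F)"
  have m: "holmes_thompson_measure A F = m"
    unfolding m_def F using A R by (rule holmes_thompson_measure_randers)
  have K: "K \<ge> 1"
    unfolding K_def using fin by (rule reversibility_ge_1[rotated]) (simp add: F randers_pos[OF R])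
  have comparable: "dual_comparable K F N" "dual_comparable K N F"
    unfolding K_def N_def F by (rule dual_comparable_randers[OF R fin[unfolded F]])+
  have "sobolev A F m p = sobolev A N m p"
    using sobolev_subset[OF A K p] comparable by blast
  then have admissible: "admissible A F m p = admissible A N m p"
    by (simp add: admissible_def)
  have adm_sub: "admissible A N m p \<subseteq> sobolev A N m p" "admissible A N m p \<subseteq> sobolev A F m p"
    using \<open>sobolev A F m p = sobolev A N m p\<close> by (auto simp: admissible_def)
  have "eigenvalue_finsler A F m p = (INF (f, \<omega>) \<in> admissible A F m p.
     (\<integral>\<^sup>+ x. ennreal (dual F x (\<omega> x) powr p) \<partial>m) / (\<integral>\<^sup>+ x. ennreal (\<bar>f x\<bar> powr p) \<partial>m))"
    by (rule eigenvalue_finsler_cong_integrand)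
      (simp add: F legendre_dual_randers[OF R sobolev_linear])
  moreover have "eigenvalue_riemannian A g p = (INF (f, \<omega>) \<in> admissible A N m p.
     (\<integral>\<^sup>+ x. ennreal (dual N x (\<omega> x) powr p) \<partial>m) / (\<integral>\<^sup>+ x. ennreal (\<bar>f x\<bar> powr p) \<partial>m))"
    by (simp add: eigenvalue_riemannian_def m_def N_def)
  ultimately have upper: "eigenvalue_finsler A F m p \<le> ennreal (K powr p) * eigenvalue_riemannian A g p"
    and lower: "eigenvalue_riemannian A g p \<le> ennreal (K powr p) * eigenvalue_finsler A F m p"
    unfolding admissible
    using rayleigh_INF_le[OF K p comparable adm_sub(2)]
      rayleigh_INF_le[OF K p comparable(2,1) adm_sub(1)] by simp_all
  have epowr: "epowr (reversibility F) p = ennreal (K powr p)"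
    using False by (simp add: epowr_def K_def)
  have pos: "K powr p > 0"
    using K by simp
  have "1 / ennreal (K powr p) * eigenvalue_riemannian A g p \<le>
      1 / ennreal (K powr p) * (ennreal (K powr p) * eigenvalue_finsler A F m p)"
    using lower by (rule mult_left_mono) simp
  also have "\<dots> = eigenvalue_finsler A F m p"
    using pos by (simp add: mult.assoc[symmetric] ennreal_divide_times)
  finally show ?thesis
    using upper False by (simp add: epowr m)
qed

end
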